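(* Let $K$ be a number field of degree $d$ and discriminant $\Delta_K$. Let $V \subseteq K^n$ be an $m$-dimensional subspace and $F$ a multilinear $(n,g)$-form over $K$. Assume that $m+g-1 > n$ and $g > 1$. Then $V$ contains a basis $\boldsymbol{x}_1,\dots,\boldsymbol{x}_m$ of vectors such that $F(\boldsymbol{x}_1) = \dots = F(\boldsymbol{x}_m) = 0$ and $$H(\boldsymbol{x}_i) \le \sqrt{2}\, m\, |\Delta_K|^{\frac{m+1}{2d}}\, \mathcal{H}(V)$$ for each $1\le i\le m$. Further, suppose that $P(x_1,\dots,x_n)\in K[x_1,\dots,x_n]$ is a polynomial such that, with $Z_K(P,V) := \{\boldsymbol{z} \in V : P(\boldsymbol{z}) = 0\}$, $$D(P,V) := \dim \operatorname{span}_K Z_K(P,V) < m.$$ Then there exists a point $\boldsymbol{z}\in V\setminus Z_K(P,V)$ such that $F(\boldsymbol{z}) = 0$ and $$H(\boldsymbol{z}) \le \sqrt{2}\, m\, |\Delta_K|^{\frac{m+1}{2d}}\, \mathcal{H}(V).$$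
   Context: A multilinear $(n,g)$-form over $K$ is a homogeneous polynomial in $K[x_1,\dots,x_n]$ of degree $g$ that is linear in every variable, i.e. each of its monomials is a constant times a product of $g$ distinct variables. Heights: let $M(K)$ be the set of places of $K$, and for $v\in M(K)$ let $d_v = [K_v:\mathbb{Q}_v]$ be the local degree. The absolute value $|\cdot|_v$ is normalized to extend the usual archimedean or $p$-adic absolute value on $\mathbb{Q}$, so that $\prod_{v\in M(K)} |x|_v^{d_v} = 1$ for all nonzero $x\in K$. For a vector $\boldsymbol{x} = (x_1,\dots,x_N)$ over $K$ put $|\boldsymbol{x}|_v = \max_i |x_i|_v$ and, for $v\mid\infty$, $\|\boldsymbol{x}\|_v = \left(\sum_i |x_i|_v^2\right)^{1/2}$. Define $$H(\boldsymbol{x}) = \Big(\prod_{v\in M(K)} |\boldsymbol{x}|_v^{d_v}\Big)^{1/d},\qquad \mathcal{H}(\boldsymbol{x}) = \Big(\prod_{v\nmid\infty} |\boldsymbol{x}|_v^{d_v} \times \prod_{v\mid\infty}\|\boldsymbol{x}\|_v^{d_v}\Big)^{1/d}.$$ For an $m$-dimensional subspace $V\subseteq K^n$, $1\le m\le n$, with basis $\boldsymbol{v}_1,\dots,\boldsymbol{v}_m$, the Schmidt height is $\mathcal{H}(V) = \mathcal{H}(\boldsymbol{v}_1\wedge\dots\wedge\boldsymbol{v}_m)$, where the wedge product is identified with the vector of Grassmann (Plücker) coordinates in $K^{\binom{n}{m}}$ (the $m\times m$ minors of the $n\times m$ basis matrix); this does not depend on the choice of basis. *)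

theory Defs
  imports
    "HOL-Analysis.Analysis"
    "HOL-Algebra.Embedded_Algebras"
    "HOL-Algebra.QuotRing"
    "HOL-Library.Poly_Mapping"
    "Jordan_Normal_Form.Determinant"
begin

text \<open>
  HOL-Analysis and Jordan_Normal_Form share several names. Below, \<open>Matrix.mat\<close> and
  \<open>Determinant.det\<close> are the matrices and determinants of Jordan_Normal_Form, whose size is a
  natural number; \<open>vec.\<close> is the linear algebra of \<open>'k ^ 'n\<close>, and \<open>$\<close> is its coordinate access.
\<close>

no_notation vec_index (infixl \<open>$\<close> 100)

section \<open>Number fields\<close>

class number_field = field_char_0 +
  assumes finite_over_rat:
    "\<exists>B :: 'a set. finite B \<and> (\<forall>x. \<exists>c. x = (\<Sum>b\<in>B. of_rat (c b) * b))"

instance rat :: number_field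
proof
  show "\<exists>B :: rat set. finite B \<and> (\<forall>x. \<exists>c. x = (\<Sum>b\<in>B. of_rat (c b) * b))"
    by (intro exI[of _ "{1}"] conjI allI, simp) (rule_tac x = "\<lambda>_. x" in exI, simp)
qed

definition rat_scale :: "rat \<Rightarrow> 'k \<Rightarrow> 'k :: field_char_0" where
  "rat_scale q x = of_rat q * x"

interpretation rat_vs: vector_space "rat_scale :: rat \<Rightarrow> 'k \<Rightarrow> 'k :: field_char_0"
  by unfold_locales (simp_all add: rat_scale_def of_rat_add of_rat_mult algebra_simps)

definition nf_degree :: "'k :: number_field itself \<Rightarrow> nat" where
  "nf_degree _ = rat_vs.dim (UNIV :: 'k set)"

text \<open>
  The trace of the \<open>\<rat>\<close>-linear map \<open>y \<mapsto> x y\<close>; it does not depend on the basis that is chosen.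
\<close>

definition nf_trace :: "'k :: number_field \<Rightarrow> rat" where
  "nf_trace x =
     (let B = (SOME B :: 'k set. rat_vs.independent B \<and> rat_vs.span B = UNIV)
      in \<Sum>b\<in>B. rat_vs.representation B (x * b) b)"

definition ring_of_integers :: "'k :: number_field set" where
  "ring_of_integers = {x. algebraic_int x}"

definition integral_basis :: "'k :: number_field list \<Rightarrow> bool" where
  "integral_basis ws \<longleftrightarrow>
     bij_betw (\<lambda>c :: int list. \<Sum>i<length ws. of_int (c ! i) * ws ! i)
       {c. length c = length ws} ring_of_integers"

text \<open>
  Two integral bases differ by an integer matrix of determinant \<open>\<plusminus>1\<close>, so the choice is immaterial.
\<close>

definition discriminant :: "'k :: number_field itself \<Rightarrow> rat" where
  "discriminant _ =
     (let ws = (SOME ws :: 'k list. integral_basis ws)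
      in Determinant.det
           (Matrix.mat (length ws) (length ws) (\<lambda>(i, j). nf_trace (ws ! i * ws ! j))))"

section \<open>Places and local degrees\<close>

definition absolute_value :: "('k :: field \<Rightarrow> real) \<Rightarrow> bool" where
  "absolute_value v \<longleftrightarrow>
     (\<forall>x. 0 \<le> v x) \<and> (\<forall>x. v x = 0 \<longleftrightarrow> x = 0) \<and>
     (\<forall>x y. v (x * y) = v x * v y) \<and> (\<forall>x y. v (x + y) \<le> v x + v y)"

definition padic_abs :: "nat \<Rightarrow> rat \<Rightarrow> real" where
  "padic_abs p q =
     (if q = 0 then 0
      else real p powi (int (multiplicity (int p) (snd (quotient_of q)))
                      - int (multiplicity (int p) (fst (quotient_of q)))))"

text \<open>
  A place, i.e. a class of equivalent nontrivial absolute values, is represented by its normalized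
  member: the unique absolute value in the class whose restriction to \<open>\<rat>\<close> is the usual
  absolute value or one of the usual \<open>p\<close>-adic ones.
\<close>

definition archimedean_place :: "('k :: number_field \<Rightarrow> real) \<Rightarrow> bool" where
  "archimedean_place v \<longleftrightarrow> absolute_value v \<and> (\<forall>q. v (of_rat q) = \<bar>real_of_rat q\<bar>)"

definition nonarchimedean_place :: "('k :: number_field \<Rightarrow> real) \<Rightarrow> bool" where
  "nonarchimedean_place v \<longleftrightarrow>
     absolute_value v \<and> (\<exists>p. prime p \<and> (\<forall>q. v (of_rat q) = padic_abs p q))"

definition places :: "('k :: number_field \<Rightarrow> real) set" where
  "places = {v. archimedean_place v \<or> nonarchimedean_place v}"

text \<open>
  The completion \<open>K\<^sub>v\<close> is the ring of \<open>v\<close>-Cauchy sequences modulo the ideal of null sequences;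
  \<open>\<rat>\<^sub>v\<close> is the subfield of the classes of rational Cauchy sequences.
\<close>

definition cauchy_ring :: "('k :: number_field \<Rightarrow> real) \<Rightarrow> (nat \<Rightarrow> 'k) ring" where
  "cauchy_ring v =
     \<lparr>carrier = {s. \<forall>e>0. \<exists>N. \<forall>i\<ge>N. \<forall>j\<ge>N. v (s i - s j) < e},
      monoid.mult = (\<lambda>s t i. s i * t i),
      one = (\<lambda>i. 1),
      zero = (\<lambda>i. 0),
      add = (\<lambda>s t i. s i + t i)\<rparr>"

definition null_sequences :: "('k :: number_field \<Rightarrow> real) \<Rightarrow> (nat \<Rightarrow> 'k) set" where
  "null_sequences v = {s. (\<lambda>i. v (s i)) \<longlonglongrightarrow> 0}"

definition completion :: "('k :: number_field \<Rightarrow> real) \<Rightarrow> (nat \<Rightarrow> 'k) set ring" where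
  "completion v = cauchy_ring v Quot null_sequences v"

definition rat_completion :: "('k :: number_field \<Rightarrow> real) \<Rightarrow> (nat \<Rightarrow> 'k) set set" where
  "rat_completion v =
     (\<lambda>s. null_sequences v +>\<^bsub>cauchy_ring v\<^esub> s) ` {s \<in> carrier (cauchy_ring v). range s \<subseteq> \<rat>}"

definition local_degree :: "('k :: number_field \<Rightarrow> real) \<Rightarrow> nat" where
  "local_degree v = ring.dim (completion v) (rat_completion v) (carrier (completion v))"

section \<open>Heights\<close>

text \<open>
  For a nonzero vector only finitely many factors of the products below differ from \<open>1\<close>.
  For the zero vector every factor is \<open>0\<close>, hence the second case.
\<close>

definition place_prod :: "(('k :: number_field \<Rightarrow> real) \<Rightarrow> real) \<Rightarrow> real" where
  "place_prod f =
     (if finite {v \<in> places. f v \<noteq> 1} then (\<Prod>v\<in>{v \<in> places. f v \<noteq> 1}. f v) else 0)"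

text \<open>
  Vectors are families \<open>x\<close> over a finite nonempty index set \<open>I\<close>: the coordinates of a
  point of \<open>K\<^sup>n\<close>, or the Grassmann coordinates of a subspace.
\<close>

definition max_abs :: "('k :: number_field \<Rightarrow> real) \<Rightarrow> 'i set \<Rightarrow> ('i \<Rightarrow> 'k) \<Rightarrow> real" where
  "max_abs v I x = Max ((\<lambda>i. v (x i)) ` I)"

definition height :: "'i set \<Rightarrow> ('i \<Rightarrow> 'k :: number_field) \<Rightarrow> real" where
  "height I x = root (nf_degree TYPE('k)) (place_prod (\<lambda>v. max_abs v I x ^ local_degree v))"

definition l2_height :: "'i set \<Rightarrow> ('i \<Rightarrow> 'k :: number_field) \<Rightarrow> real" where
  "l2_height I x =
     root (nf_degree TYPE('k))
       (place_prod (\<lambda>v. (if archimedean_place v then L2_set (\<lambda>i. v (x i)) I else max_abs v I x)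
                         ^ local_degree v))"

definition vec_height :: "'k :: number_field ^ 'n \<Rightarrow> real" where
  "vec_height x = height UNIV (\<lambda>i. x $ i)"

definition basis_list :: "('k :: field ^ 'n) list \<Rightarrow> ('k ^ 'n) set \<Rightarrow> bool" where
  "basis_list xs V \<longleftrightarrow> distinct xs \<and> vec.independent (set xs) \<and> vec.span (set xs) = V"

text \<open>
  The coordinate of \<open>x\<^sub>1 \<and> \<dots> \<and> x\<^sub>m\<close> at a set \<open>I\<close> of \<open>m\<close> row indices: the minor with rows \<open>I\<close>
  (in increasing order) of the matrix with columns \<open>x\<^sub>1, \<dots>, x\<^sub>m\<close>.
\<close>

definition grassmann_coord ::
  "('k :: field ^ 'n :: {finite, linorder}) list \<Rightarrow> 'n set \<Rightarrow> 'k" where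
  "grassmann_coord xs I =
     Determinant.det
       (Matrix.mat (length xs) (length xs) (\<lambda>(i, j). (xs ! j) $ (sorted_list_of_set I ! i)))"

definition schmidt_height :: "('k :: number_field ^ 'n :: {finite, linorder}) set \<Rightarrow> real" where
  "schmidt_height V =
     (let xs = (SOME xs. basis_list xs V)
      in l2_height {I. card I = length xs} (grassmann_coord xs))"

section \<open>Polynomials in the coordinates\<close>

type_synonym ('n, 'k) mpoly = "('n \<Rightarrow>\<^sub>0 nat) \<Rightarrow>\<^sub>0 'k"

definition mpoly_eval :: "('n :: finite, 'k :: field) mpoly \<Rightarrow> 'k ^ 'n \<Rightarrow> 'k" where
  "mpoly_eval p x =
     (\<Sum>e\<in>Poly_Mapping.keys p.
        Poly_Mapping.lookup p e * (\<Prod>i\<in>UNIV. x $ i ^ Poly_Mapping.lookup e i))"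

definition multilinear_form :: "nat \<Rightarrow> ('n :: finite, 'k :: field) mpoly \<Rightarrow> bool" where
  "multilinear_form g p \<longleftrightarrow>
     (\<forall>e\<in>Poly_Mapping.keys p.
        (\<Sum>i\<in>UNIV. Poly_Mapping.lookup e i) = g \<and> (\<forall>i. Poly_Mapping.lookup e i \<le> 1))"

definition zero_set :: "('n :: finite, 'k :: field) mpoly \<Rightarrow> ('k ^ 'n) set \<Rightarrow> ('k ^ 'n) set" where
  "zero_set p V = {z \<in> V. mpoly_eval p z = 0}"

end

theory Submission
  imports
    Defs
    "Jordan_Normal_Form.Schur_Decomposition"
begin

text \<open>
  The required vectors are suitable multiples of a reduced echelon basis of \<open>V\<close>. Such a basis
  \<open>x\<^sub>i\<close> is indexed by a set \<open>I\<close> of \<open>m\<close> pivots, and \<open>x\<^sub>i\<close> vanishes at all pivots except \<open>i\<close>.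
  So at most \<open>n - m + 1 < g\<close> coordinates of \<open>x\<^sub>i\<close> are nonzero, whereas every monomial of \<open>F\<close> is
  a product of \<open>g\<close> distinct variables: every multiple of \<open>x\<^sub>i\<close> is a zero of \<open>F\<close>
  (\<open>multilinear_form_vanishes\<close>).

  By Cramer's rule (\<open>grassmann_coord_exchange\<close>) the coordinates of \<open>x\<^sub>i\<close> outside \<open>I\<close> are, up to
  sign, quotients of Grassmann coordinates of \<open>V\<close>, with the coordinate at \<open>I\<close> as the common
  denominator. Multiplied by that denominator, \<open>x\<^sub>i\<close> becomes a vector whose coordinates are \<open>0\<close> or,
  up to sign, Grassmann coordinates in the very basis that computes the Schmidt height. At every
  place its maximum norm is therefore bounded by the local norm of the Grassmann vector, and its
  height by \<open>schmidt_height V\<close> (\<open>sparse_basis_of_small_height\<close>). The second claim follows from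
  the first: a basis of \<open>V\<close> does not fit into a set whose span has dimension less than \<open>m\<close>.

  Two facts about number fields enter. The product over all places that defines the Schmidt height
  has only finitely many factors different from \<open>1\<close> (\<open>finite_nontrivial_places\<close>). An element of
  \<open>K\<^sup>*\<close> has absolute value \<open>1\<close> above almost all primes, because it and its inverse act on \<open>K\<close>
  by rational matrices with finitely many denominators; and only finitely many absolute values
  restrict to a given one on \<open>\<rat>\<close>, because by weak approximation \<open>N\<close> of them provide \<open>N\<close>
  elements of \<open>K\<close> that are linearly independent over \<open>\<rat>\<close>.

  Moreover \<open>\<bar>\<Delta>\<^sub>K\<bar> \<ge> 1\<close> (\<open>abs_discriminant_ge_1\<close>), so that for \<open>m \<ge> 1\<close> the constant in the theorem is at least
  \<open>1\<close>. The discriminant is a determinant of traces of algebraic integers, hence an integer; it does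
  not vanish because the trace form is nondegenerate. An integral basis is found among the
  \<open>\<rat>\<close>-bases of algebraic integers as one whose trace determinant has minimal absolute value.
\<close>

text \<open>Throughout, \<open>$\<close> is the coordinate access of \<open>'k ^ 'n\<close>.\<close>

no_notation vec_index (infixl \<open>$\<close> 100)

section \<open>Echelon bases and Grassmann coordinates\<close>

lemma (in vector_space) sum_list_family_eq_0D:
  assumes "distinct ys" "independent (set ys)"
    and "(\<Sum>j<length ys. scale (c j) (ys ! j)) = 0" and "j < length ys"
  shows "c j = 0"
proof -
  have bij: "bij_betw (\<lambda>j. ys ! j) {..<length ys} (set ys)"
    using assms(1) by (rule bij_betw_nth) auto
  define w where "w y = c (the_inv_into {..<length ys} (\<lambda>j. ys ! j) y)" for y
  have w: "w (ys ! j) = c j" if "j < length ys" for j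
    using the_inv_into_f_f[OF bij_betw_imp_inj_on[OF bij], of j] that by (simp add: w_def)
  have "(\<Sum>y\<in>set ys. scale (w y) y) = (\<Sum>j<length ys. scale (w (ys ! j)) (ys ! j))"
    by (rule sum.reindex_bij_betw[OF bij, symmetric])
  also have "\<dots> = 0" using assms(3) w by simp
  finally have "w (ys ! j) = 0"
    using independentD[OF assms(2) _ subset_refl, of w "ys ! j"] assms(4) by auto
  thus ?thesis using w[OF assms(4)] by simp
qed

text \<open>
  The matrix of a base change that replaces one vector. It occurs when a pivot is exchanged, and
  when one member of a basis of a number field is replaced.
\<close>

lemma det_identity_replace_row:
  fixes c :: "nat \<Rightarrow> 'a :: comm_ring_1"
  assumes "k < n"
  shows "Determinant.det (Matrix.mat n n (\<lambda>(i, j). if i = k then c j else if i = j then 1 else 0)) = c k"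
    (is "Determinant.det ?A = _")
proof -
  have A: "?A \<in> carrier_mat n n" by simp
  have "Determinant.det ?A = (\<Sum>i<n. ?A $$ (i, k) * cofactor ?A i k)"
    by (rule laplace_expansion_column[OF A assms])
  also have "\<dots> = (\<Sum>i<n. if i = k then c k * cofactor ?A k k else 0)"
    using assms by (intro sum.cong) auto
  also have "\<dots> = c k * cofactor ?A k k" using assms by simp
  also have "cofactor ?A k k = 1"
  proof -
    have "mat_delete ?A k k = 1\<^sub>m (n - 1)"
      using assms by (intro eq_matI) (auto simp: mat_delete_def)
    thus ?thesis by (simp add: cofactor_def)
  qed
  finally show ?thesis by simp
qed

text \<open>
  The pivots form a set \<open>I\<close> of minimal size among those that determine the vectors of \<open>V\<close> by
  their coordinates in \<open>I\<close>. By minimality, for each \<open>i \<in> I\<close> some nonzero vector of \<open>V\<close> vanishes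
  on \<open>I - {i}\<close>; its \<open>i\<close>-th coordinate is nonzero and can be scaled to \<open>1\<close>.
\<close>

lemma echelon_basis:
  fixes V :: "('k :: field ^ 'n :: finite) set"
  assumes V: "vec.subspace V"
  obtains I x where "card I = vec.dim V"
    and "\<And>i. i \<in> I \<Longrightarrow> x i \<in> V"
    and "\<And>i j. i \<in> I \<Longrightarrow> j \<in> I \<Longrightarrow> x i $ j = (if i = j then 1 else 0)"
    and "\<And>y. y \<in> V \<Longrightarrow> y = (\<Sum>i\<in>I. y $ i *s x i)"
proof -
  define determining where "determining I \<longleftrightarrow> (\<forall>y\<in>V. (\<forall>i\<in>I. y $ i = 0) \<longrightarrow> y = 0)" for I
  have "determining UNIV" by (auto simp: determining_def Finite_Cartesian_Product.vec_eq_iff)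
  from ex_has_least_nat[of determining, OF this, of card]
  obtain I where I: "determining I" and min: "\<And>J. determining J \<Longrightarrow> card I \<le> card J" by blast
  have "\<exists>x\<in>V. x $ i = 1 \<and> (\<forall>j\<in>I - {i}. x $ j = 0)" if "i \<in> I" for i
  proof -
    have "card (I - {i}) < card I" using that by (intro psubset_card_mono) auto
    hence "\<not> determining (I - {i})" using min[of "I - {i}"] by auto
    then obtain y where y: "y \<in> V" "\<forall>j\<in>I - {i}. y $ j = 0" "y \<noteq> 0"
      by (auto simp: determining_def)
    hence "y $ i \<noteq> 0" using I unfolding determining_def by (metis DiffI singletonD)
    thus ?thesis using y vec.subspace_scale[OF V y(1)]
      by (intro bexI[of _ "inverse (y $ i) *s y"]) auto
  qed
  hence "\<forall>i\<in>I. \<exists>x. x \<in> V \<and> x $ i = 1 \<and> (\<forall>j\<in>I - {i}. x $ j = 0)" by blast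
  then obtain x where "\<forall>i\<in>I. x i \<in> V \<and> x i $ i = 1 \<and> (\<forall>j\<in>I - {i}. x i $ j = 0)"
    by (rule bchoice[THEN exE])
  hence x: "\<And>i. i \<in> I \<Longrightarrow> x i \<in> V"
    "\<And>i. i \<in> I \<Longrightarrow> x i $ i = 1 \<and> (\<forall>j\<in>I - {i}. x i $ j = 0)" by auto
  have delta: "x i $ j = (if i = j then 1 else 0)" if "i \<in> I" "j \<in> I" for i j
    using x(2)[OF that(1)] that by auto
  have coord: "(\<Sum>i\<in>I. c i *s x i) $ j = c j" if "j \<in> I" for c :: "'n \<Rightarrow> 'k" and j
  proof -
    have "(\<Sum>i\<in>I. c i *s x i) $ j = (\<Sum>i\<in>I. if i = j then c i else 0)"
      unfolding sum_component using delta that by (intro sum.cong) auto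
    thus ?thesis using that by simp
  qed
  have expand: "y = (\<Sum>i\<in>I. y $ i *s x i)" if "y \<in> V" for y
  proof -
    have "y - (\<Sum>i\<in>I. y $ i *s x i) \<in> V"
      using that x(1) by (intro vec.subspace_diff[OF V] vec.subspace_sum[OF V] vec.subspace_scale[OF V]) auto
    moreover have "\<forall>j\<in>I. (y - (\<Sum>i\<in>I. y $ i *s x i)) $ j = 0" using coord by simp
    ultimately have "y - (\<Sum>i\<in>I. y $ i *s x i) = 0" using I unfolding determining_def by blast
    thus ?thesis by simp
  qed
  have inj: "inj_on x I"
  proof (rule inj_onI, rule ccontr)
    fix i j assume "i \<in> I" "j \<in> I" "x i = x j" "i \<noteq> j"
    thus False using delta[of i j] delta[of j j] by simp
  qed
  have "vec.independent (x ` I)"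
  proof
    assume "vec.dependent (x ` I)"
    then obtain c where c: "\<exists>y\<in>x ` I. c y \<noteq> 0" "(\<Sum>y\<in>x ` I. c y *s y) = 0"
      by (subst (asm) vec.dependent_finite) auto
    have "(\<Sum>i\<in>I. c (x i) *s x i) = 0" using c(2) by (simp add: sum.reindex[OF inj])
    hence "c (x i) = 0" if "i \<in> I" for i using coord[OF that, of "\<lambda>i. c (x i)"] by simp
    thus False using c(1) by auto
  qed
  moreover have "V \<subseteq> vec.span (x ` I)"
  proof
    fix y assume "y \<in> V"
    have "(\<Sum>i\<in>I. y $ i *s x i) \<in> vec.span (x ` I)"
      by (intro vec.span_sum vec.span_scale vec.span_base imageI)
    thus "y \<in> vec.span (x ` I)" using expand[OF \<open>y \<in> V\<close>] by (rule back_subst[OF _ sym])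
  qed
  ultimately have "card (x ` I) = vec.dim V"
    using x(1) by (intro vec.basis_card_eq_dim) auto
  hence dim: "card I = vec.dim V" by (simp add: card_image[OF inj])
  show ?thesis by (rule that[OF dim x(1) delta expand])
qed

text \<open>
  Exchanging a pivot in place leaves the row indices out of order, while a Grassmann coordinate
  has them in increasing order.
\<close>

lemma grassmann_coord_reorder:
  fixes ys :: "('k :: field ^ 'n :: {finite, linorder}) list"
  assumes "distinct L" "length L = length ys"
  shows "\<exists>p. Determinant.det (Matrix.mat (length ys) (length ys) (\<lambda>(i, j). (ys ! j) $ (L ! i)))
           = signof p * grassmann_coord ys (set L)"
proof -
  let ?S = "sorted_list_of_set (set L)" and ?m = "length ys"
  let ?A = "Matrix.mat ?m ?m (\<lambda>(i, j). (ys ! j) $ (?S ! i))"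
  have len: "length ?S = ?m" using assms distinct_card[OF assms(1)] by simp
  have "mset L = mset ?S"
    using assms(1) by (subst set_eq_iff_mset_eq_distinct[symmetric]) auto
  then obtain p where p: "p permutes {..<length ?S}" "permute_list p ?S = L"
    by (rule mset_eq_permutation)
  have "L ! i = ?S ! p i" if "i < ?m" for i
    using permute_list_nth[OF p(1), of i] p(2) that len by simp
  hence "Matrix.mat ?m ?m (\<lambda>(i, j). (ys ! j) $ (L ! i)) = Matrix.mat ?m ?m (\<lambda>(i, j). ?A $$ (p i, j))"
    using p(1) len permutes_in_image[OF p(1)] by (intro eq_matI) auto
  hence "Determinant.det (Matrix.mat ?m ?m (\<lambda>(i, j). (ys ! j) $ (L ! i)))
      = Determinant.det (Matrix.mat ?m ?m (\<lambda>(i, j). ?A $$ (p i, j)))" by simp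
  also have "\<dots> = signof p * Determinant.det ?A"
    using p(1) len by (intro det_permute_rows) (auto simp: lessThan_atLeast0)
  also have "Determinant.det ?A = grassmann_coord ys (set L)" by (simp add: grassmann_coord_def)
  finally show ?thesis by blast
qed

text \<open>
  Cramer's rule. Let \<open>X\<close> and \<open>Y\<close> be the matrices with columns \<open>x i\<close> and \<open>ys\<close>, and \<open>Y\<^sub>I\<close> the
  pivot rows of \<open>Y\<close>. Expanding the columns of \<open>Y\<close> in the echelon basis gives \<open>Y = X Y\<^sub>I\<close>. In the
  rows obtained from \<open>I\<close> by putting \<open>r\<close> in the place of \<open>i\<close>, the matrix \<open>X\<close> is the identity with
  one row replaced, and its determinant is the coordinate \<open>x i $ r\<close>. The matrix \<open>Y\<^sub>I\<close> is invertible
  because a vector of \<open>V\<close> that vanishes at the pivots is zero.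
\<close>

lemma grassmann_coord_echelon:
  fixes V :: "('k :: field ^ 'n :: {finite, linorder}) set"
  assumes ys: "basis_list ys V" "length ys = card I"
    and delta: "\<And>i j. i \<in> I \<Longrightarrow> j \<in> I \<Longrightarrow> x i $ j = (if i = j then 1 else 0)"
    and expand: "\<And>y. y \<in> V \<Longrightarrow> y = (\<Sum>i\<in>I. y $ i *s x i)"
  shows grassmann_coord_pivots_nonzero: "grassmann_coord ys I \<noteq> 0"
    and grassmann_coord_exchange: "i \<in> I \<Longrightarrow> r \<notin> I \<Longrightarrow>
      \<exists>p. grassmann_coord ys I * x i $ r = signof p * grassmann_coord ys (insert r (I - {i}))"
proof -
  let ?m = "length ys" and ?L = "sorted_list_of_set I"
  let ?Y = "\<lambda>L. Matrix.mat ?m ?m (\<lambda>(i, j). (ys ! j) $ (L ! i))"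
  have L: "length ?L = ?m" "set ?L = I" "distinct ?L" using ys(2) by auto
  have Y: "grassmann_coord ys I = Determinant.det (?Y ?L)" by (simp add: grassmann_coord_def)
  have index: "\<exists>b<?m. i = ?L ! b" if "i \<in> I" for i
  proof -
    have "i \<in> set ?L" using that L(2) by simp
    thus ?thesis unfolding in_set_conv_nth L(1) by blast
  qed
  have LI: "?L ! b \<in> I" if "b < ?m" for b
    using nth_mem[of b ?L] that L(1,2) by simp
  have ysV: "ys ! j \<in> V" if "j < ?m" for j
    using ys(1) that vec.span_base[of "ys ! j" "set ys"] by (auto simp: basis_list_def)
  have bij: "bij_betw (\<lambda>b. ?L ! b) {..<?m} I"
    using L by (intro bij_betw_nth) auto
  show "grassmann_coord ys I \<noteq> 0"
  proof
    assume "grassmann_coord ys I = 0"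
    hence "Determinant.det (?Y ?L) = 0" using Y by simp
    then obtain v where v: "v \<in> carrier_vec ?m" "v \<noteq> 0\<^sub>v ?m" "?Y ?L *\<^sub>v v = 0\<^sub>v ?m"
      using det_0_iff_vec_prod_zero[of "?Y ?L" ?m] by auto
    define u where "u = (\<Sum>j<?m. vec_index v j *s ys ! j)"
    have "u \<in> vec.span (set ys)" unfolding u_def
      by (intro vec.span_sum vec.span_scale vec.span_base) auto
    hence uV: "u \<in> V" using ys(1) by (simp add: basis_list_def)
    have "u $ i = 0" if i: "i \<in> I" for i
    proof -
      obtain b where b: "b < ?m" "i = ?L ! b" using index[OF i] by blast
      have "0 = vec_index (?Y ?L *\<^sub>v v) b" unfolding v(3) using b by simp
      also have "\<dots> = (\<Sum>j<?m. (ys ! j) $ i * vec_index v j)"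
        using v(1) b by (simp add: scalar_prod_def lessThan_atLeast0)
      also have "\<dots> = u $ i" by (simp add: u_def sum_component mult.commute)
      finally show ?thesis by simp
    qed
    hence "(\<Sum>i\<in>I. u $ i *s x i) = 0" by simp
    hence "u = 0" using expand[OF uV] by (rule trans[rotated])
    hence "vec_index v j = 0" if "j < ?m" for j
      using vec.sum_list_family_eq_0D[of ys "vec_index v" j] ys(1) that by (simp add: u_def basis_list_def)
    hence "v = 0\<^sub>v ?m" using v(1) by (intro eq_vecI) auto
    thus False using v(2) by simp
  qed
  assume i: "i \<in> I" and r: "r \<notin> I"
  obtain k where k: "k < ?m" "i = ?L ! k" using index[OF i] by blast
  let ?L' = "?L[k := r]"
  have L': "set ?L' = insert r (I - {i})" "distinct ?L'" "length ?L' = ?m"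
    using k L r set_update_distinct[of ?L k r] by (auto simp: distinct_list_update)
  \<comment> \<open>The rows of \<open>X\<close> at \<open>?L'\<close>; \<open>?Y ?L\<close> is \<open>Y\<^sub>I\<close>.\<close>
  let ?X = "Matrix.mat ?m ?m (\<lambda>(a, b). if a = k then x (?L ! b) $ r else if a = b then 1 else 0)"
  have YX: "?Y ?L' = ?X * ?Y ?L"
  proof (intro eq_matI)
    fix a j assume "a < dim_row (?X * ?Y ?L)" "j < dim_col (?X * ?Y ?L)"
    hence aj: "a < ?m" "j < ?m" by auto
    have ent: "?X $$ (a, b) = x (?L ! b) $ (?L' ! a)" if "b < ?m" for b
    proof (cases "a = k")
      case False
      have "?L ! b = ?L ! a \<longleftrightarrow> b = a" using that aj L by (simp add: nth_eq_iff_index_eq)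
      thus ?thesis using False that aj(1) delta[OF LI[OF that] LI[OF aj(1)]] by auto
    qed (use that aj(1) L(1) in simp)
    have "?Y ?L' $$ (a, j) = (ys ! j) $ (?L' ! a)" using aj by simp
    also have "\<dots> = (\<Sum>i\<in>I. (ys ! j) $ i *s x i) $ (?L' ! a)"
      by (rule arg_cong[OF expand[OF ysV[OF aj(2)]]])
    also have "\<dots> = (\<Sum>i\<in>I. (ys ! j) $ i * x i $ (?L' ! a))" by (simp add: sum_component)
    also have "\<dots> = (\<Sum>b<?m. (ys ! j) $ (?L ! b) * x (?L ! b) $ (?L' ! a))"
      by (rule sum.reindex_bij_betw[OF bij, symmetric])
    also have "\<dots> = (\<Sum>b<?m. ?X $$ (a, b) * ?Y ?L $$ (b, j))"
      using ent aj by (intro sum.cong) (auto simp: mult.commute)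
    also have "\<dots> = (?X * ?Y ?L) $$ (a, j)"
      using aj by (simp add: scalar_prod_def lessThan_atLeast0)
    finally show "?Y ?L' $$ (a, j) = (?X * ?Y ?L) $$ (a, j)" .
  qed auto
  have "Determinant.det (?Y ?L') = Determinant.det ?X * Determinant.det (?Y ?L)"
    unfolding YX by (rule det_mult[of _ ?m]) auto
  also have "Determinant.det ?X = x i $ r"
    using det_identity_replace_row[OF k(1), of "\<lambda>b. x (?L ! b) $ r"] k(2) by simp
  finally have eq: "grassmann_coord ys I * x i $ r = Determinant.det (?Y ?L')" using Y by simp
  show "\<exists>p. grassmann_coord ys I * x i $ r = signof p * grassmann_coord ys (insert r (I - {i}))"
    unfolding eq using grassmann_coord_reorder[OF L'(2,3)] L'(1) by simp
qed

section \<open>Absolute values with a common restriction to the rationals\<close>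

lemma absolute_value_basics:
  fixes v :: "'k :: field \<Rightarrow> real"
  assumes "absolute_value v"
  shows absolute_value_nonneg: "0 \<le> v x"
    and absolute_value_eq_0: "v x = 0 \<longleftrightarrow> x = 0"
    and absolute_value_zero: "v 0 = 0"
    and absolute_value_mult: "v (x * y) = v x * v y"
    and absolute_value_triangle: "v (x + y) \<le> v x + v y"
    and absolute_value_pos: "0 < v x \<longleftrightarrow> x \<noteq> 0"
proof -
  show a: "0 \<le> v x" and b: "v x = 0 \<longleftrightarrow> x = 0" and "v (x * y) = v x * v y"
    and "v (x + y) \<le> v x + v y"
    using assms unfolding absolute_value_def by blast+
  show "v 0 = 0" using assms unfolding absolute_value_def by blast
  show "0 < v x \<longleftrightarrow> x \<noteq> 0" using a b by linarith
qed

lemma absolute_value_one: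
  assumes "absolute_value v"
  shows "v 1 = 1"
  using absolute_value_mult[OF assms, of 1 1] absolute_value_eq_0[OF assms, of 1] by simp

lemma absolute_value_minus:
  assumes "absolute_value v"
  shows "v (- x) = v x"
proof -
  have "(v (-1))\<^sup>2 = 1"
    using absolute_value_mult[OF assms, of "-1" "-1"] absolute_value_one[OF assms]
    by (simp add: power2_eq_square)
  hence "v (-1) = 1" using absolute_value_nonneg[OF assms, of "-1"] by (simp add: power2_eq_1_iff)
  thus ?thesis using absolute_value_mult[OF assms, of "-1" x] by simp
qed

lemma absolute_value_power:
  assumes "absolute_value v"
  shows "v (x ^ n) = v x ^ n"
  by (induction n) (simp_all add: absolute_value_one[OF assms] absolute_value_mult[OF assms])

lemma absolute_value_inverse:
  assumes "absolute_value v"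
  shows "v (inverse x) = inverse (v x)"
proof (cases "x = 0")
  case False
  hence "v x * v (inverse x) = 1"
    using absolute_value_mult[OF assms, of x "inverse x"] absolute_value_one[OF assms] by simp
  thus ?thesis by (rule inverse_unique[symmetric])
qed (simp add: absolute_value_zero[OF assms])

lemma absolute_value_divide:
  assumes "absolute_value v"
  shows "v (x / y) = v x / v y"
  by (simp add: divide_inverse absolute_value_mult[OF assms] absolute_value_inverse[OF assms])

lemma absolute_value_powi:
  assumes "absolute_value v"
  shows "v (x powi n) = v x powi n"
  by (auto simp: power_int_def absolute_value_power[OF assms] absolute_value_inverse[OF assms])

lemma absolute_value_sum:
  assumes "absolute_value v"
  shows "v (\<Sum>i\<in>I. f i) \<le> (\<Sum>i\<in>I. v (f i))"
proof (induction I rule: infinite_finite_induct)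
  case (insert i I)
  thus ?case using absolute_value_triangle[OF assms, of "f i" "sum f I"] by auto
qed (simp_all add: absolute_value_zero[OF assms])

lemma absolute_value_signof:
  assumes "absolute_value v"
  shows "v (signof p * x) = v x"
  by (simp add: sign_def absolute_value_minus[OF assms])

lemma of_rat_power_int: "of_rat (a powi n) = (of_rat a :: 'a :: field_char_0) powi n"
  by (simp add: power_int_def of_rat_power of_rat_inverse)

text \<open>
  If \<open>n\<close> is large, the interval from \<open>w (y ^ n)\<close> to \<open>v (y ^ n)\<close> is so long that some power of
  \<open>a\<close> has its absolute value, which is the same for \<open>v\<close> and \<open>w\<close>, strictly inside. Dividing
  \<open>y ^ n\<close> by that power gives \<open>x\<close>.
\<close>

lemma absolute_values_separate_less:
  fixes v w :: "'k :: field_char_0 \<Rightarrow> real"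
  assumes v: "absolute_value v" and w: "absolute_value w"
    and agree: "\<And>q. v (of_rat q) = w (of_rat q)"
    and a: "0 < v (of_rat a)" "v (of_rat a) < 1"
    and less: "w y < v y"
  shows "\<exists>x. 1 < v x \<and> w x < 1"
proof -
  define c where "c = v (of_rat a)"
  define t where "t = - ln c"
  have t: "t > 0" using a by (simp add: t_def c_def)
  have vy: "v y > 0" using less absolute_value_nonneg[OF w, of y] by linarith
  hence wy: "w y > 0" using absolute_value_pos[OF v] absolute_value_pos[OF w] by blast
  have lnpos: "ln (v y) - ln (w y) > 0" using vy wy less by simp
  obtain n :: nat where n: "t < real n * (ln (v y) - ln (w y))"
    using reals_Archimedean3[OF lnpos] by blast
  \<comment> \<open>The absolute value of \<open>a powi (- j)\<close> is \<open>exp (j * t)\<close>, which is to lie between \<open>w y ^ n\<close> and \<open>v y ^ n\<close>.\<close>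
  define j where "j = \<lfloor>real n * ln (w y) / t\<rfloor> + 1"
  have j1: "real n * ln (w y) / t < j" "j \<le> real n * ln (w y) / t + 1"
    unfolding j_def by linarith+
  have j2: "real n * ln (w y) < j * t" using j1(1) t by (simp add: field_simps)
  have "j * t \<le> real n * ln (w y) + t" using j1(2) t by (simp add: field_simps)
  hence j3: "j * t < real n * ln (v y)" using n by (simp add: algebra_simps)
  have cj: "c powi (-j) = exp (j * t)"
  proof -
    have "c = exp (- t)" using a by (simp add: t_def c_def)
    thus ?thesis by (simp add: exp_power_int)
  qed
  define b where "b = a powi (-j)"
  have vb: "v (of_rat b) = exp (j * t)"
    using absolute_value_powi[OF v, of "of_rat a" "-j"] cj by (simp add: b_def c_def of_rat_power_int)
  hence wb: "w (of_rat b) = exp (j * t)" using agree by simp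
  have "exp (j * t) < exp (real n * ln (v y))" using j3 by simp
  also have "\<dots> = v y ^ n" using vy by (simp add: exp_of_nat_mult)
  finally have 1: "1 < v (y ^ n / of_rat b)"
    using vb by (simp add: absolute_value_divide[OF v] absolute_value_power[OF v])
  have "w y ^ n = exp (real n * ln (w y))" using wy by (simp add: exp_of_nat_mult)
  also have "\<dots> < exp (j * t)" using j2 by simp
  finally have "w (y ^ n / of_rat b) < 1"
    using wb by (simp add: absolute_value_divide[OF w] absolute_value_power[OF w])
  with 1 show ?thesis by blast
qed

lemma absolute_values_separate:
  fixes v w :: "'k :: field_char_0 \<Rightarrow> real"
  assumes v: "absolute_value v" and w: "absolute_value w"
    and agree: "\<And>q. v (of_rat q) = w (of_rat q)"
    and a: "0 < v (of_rat a)" "v (of_rat a) < 1"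
    and "v \<noteq> w"
  shows "\<exists>x. 1 < v x \<and> w x < 1"
proof -
  from \<open>v \<noteq> w\<close> obtain y where y: "v y \<noteq> w y" by auto
  have "\<exists>y. w y < v y"
  proof (cases "w y < v y")
    case False
    hence lt: "v y < w y" using y by simp
    hence "w y > 0" using absolute_value_nonneg[OF v, of y] by linarith
    hence "v y > 0" using absolute_value_pos[OF v] absolute_value_pos[OF w] by blast
    hence "w (inverse y) < v (inverse y)"
      using lt by (simp add: absolute_value_inverse[OF v] absolute_value_inverse[OF w])
    thus ?thesis by blast
  qed blast
  thus ?thesis using absolute_values_separate_less[OF v w agree a] by blast
qed

lemma absolute_value_tendsto_1:
  assumes u: "absolute_value u" and f: "(\<lambda>r. u (f r)) \<longlonglongrightarrow> 0"
  shows "(\<lambda>r. u (1 + f r)) \<longlonglongrightarrow> 1"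
proof (rule tendsto_sandwich)
  show "\<forall>\<^sub>F r in sequentially. 1 - u (f r) \<le> u (1 + f r)"
  proof (intro always_eventually allI)
    fix r show "1 - u (f r) \<le> u (1 + f r)"
      using absolute_value_triangle[OF u, of "1 + f r" "- f r"]
      by (simp add: absolute_value_minus[OF u] absolute_value_one[OF u])
  qed
  show "\<forall>\<^sub>F r in sequentially. u (1 + f r) \<le> 1 + u (f r)"
    using absolute_value_triangle[OF u, of 1] by (simp add: absolute_value_one[OF u])
  show "(\<lambda>r. 1 - u (f r)) \<longlonglongrightarrow> 1" "(\<lambda>r. 1 + u (f r)) \<longlonglongrightarrow> 1"
    using tendsto_diff[OF tendsto_const f, of 1] tendsto_add[OF tendsto_const f, of 1] by auto
qed

text \<open>
  Induction on \<open>T\<close>. Let \<open>x\<close> serve for \<open>T\<close>, and let \<open>y\<close> separate \<open>v\<close> from one more absolute value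
  \<open>w\<close>. If \<open>w x \<le> 1\<close>, then \<open>x ^ r * y\<close> serves for large \<open>r\<close>. If \<open>w x > 1\<close>, the factor
  \<open>x ^ r\<close> is replaced by \<open>x ^ r / (1 + x ^ r)\<close>, whose absolute value tends to \<open>1\<close> under \<open>v\<close> and
  \<open>w\<close>, and to \<open>0\<close> under the members of \<open>T\<close>.
\<close>

lemma weak_approximation:
  fixes v :: "'k :: field_char_0 \<Rightarrow> real"
  assumes "finite T" "v \<notin> T" and v: "absolute_value v"
    and T: "\<And>w. w \<in> T \<Longrightarrow> absolute_value w"
    and agree: "\<And>w q. w \<in> T \<Longrightarrow> v (of_rat q) = w (of_rat q)"
    and a: "0 < v (of_rat a)" "v (of_rat a) < 1"
  shows "\<exists>x. 1 < v x \<and> (\<forall>w\<in>T. w x < 1)"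
  using assms(1,2) T agree
proof (induction T rule: finite_induct)
  case empty
  have "1 < v (inverse (of_rat a))"
    using a by (simp add: absolute_value_inverse[OF v] one_less_inverse)
  thus ?case by blast
next
  case (insert w T)
  have w: "absolute_value w" and "v \<noteq> w" using insert.prems by auto
  obtain x where x: "1 < v x" "\<And>u. u \<in> T \<Longrightarrow> u x < 1"
    using insert.IH insert.prems by auto
  obtain y where y: "1 < v y" "w y < 1"
    using absolute_values_separate[OF v w _ a \<open>v \<noteq> w\<close>] insert.prems by auto
  have uT: "absolute_value u" if "u \<in> T" for u using insert.prems that by auto
  have pow0: "(\<lambda>r. u x ^ r) \<longlonglongrightarrow> 0" if "u \<in> T" for u
    using x(2)[OF that] absolute_value_nonneg[OF uT[OF that], of x] by (intro LIMSEQ_realpow_zero) auto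
  show ?case
  proof (cases "w x \<le> 1")
    case True
    have "\<forall>\<^sub>F r in sequentially. u (x ^ r * y) < 1" if "u \<in> T" for u
    proof -
      have "(\<lambda>r. u x ^ r * u y) \<longlonglongrightarrow> 0 * u y" by (intro tendsto_intros pow0 that)
      hence "\<forall>\<^sub>F r in sequentially. u x ^ r * u y < 1" by (rule order_tendstoD) simp
      thus ?thesis by (simp add: absolute_value_mult[OF uT[OF that]] absolute_value_power[OF uT[OF that]])
    qed
    hence "\<forall>\<^sub>F r in sequentially. \<forall>u\<in>T. u (x ^ r * y) < 1"
      using insert.hyps(1) by (simp add: eventually_ball_finite)
    then obtain r where r: "\<forall>u\<in>T. u (x ^ r * y) < 1"
      using eventually_happens'[OF sequentially_bot] by blast
    have "1 < v (x ^ r * y)"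
    proof -
      have "1 \<le> v x ^ r" using x(1) by simp
      hence "1 * v y \<le> v x ^ r * v y" using y(1) by (intro mult_right_mono) auto
      hence "1 < v x ^ r * v y" using y(1) by linarith
      thus ?thesis by (simp add: absolute_value_mult[OF v] absolute_value_power[OF v])
    qed
    moreover have "w (x ^ r * y) < 1"
    proof -
      have "w x ^ r \<le> 1" using True absolute_value_nonneg[OF w, of x] by (intro power_le_one) auto
      hence "w x ^ r * w y \<le> 1 * w y" using absolute_value_nonneg[OF w] by (intro mult_right_mono) auto
      hence "w x ^ r * w y < 1" using y(2) by linarith
      thus ?thesis by (simp add: absolute_value_mult[OF w] absolute_value_power[OF w])
    qed
    ultimately show ?thesis using r by auto
  next
    case False
    hence wx: "1 < w x" by simp
    \<comment> \<open>Writing \<open>x ^ r / (1 + x ^ r)\<close> in this form gives the limit \<open>1\<close> directly where \<open>x\<close> is large.\<close>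
    define s where "s r = inverse (1 + inverse x ^ r)" for r
    have lim1: "(\<lambda>r. u (s r)) \<longlonglongrightarrow> 1" if u: "absolute_value u" and ux: "1 < u x" for u
    proof -
      have l0: "(\<lambda>r. u (inverse x ^ r)) \<longlonglongrightarrow> 0"
        unfolding absolute_value_power[OF u] absolute_value_inverse[OF u]
        using ux by (intro LIMSEQ_realpow_zero) (auto simp: inverse_less_1_iff)
      from tendsto_inverse[OF absolute_value_tendsto_1[OF u l0]] show ?thesis
        by (simp add: s_def absolute_value_inverse[OF u])
    qed
    have lim0: "(\<lambda>r. u (s r)) \<longlonglongrightarrow> 0" if uT': "u \<in> T" for u
    proof -
      note u = uT[OF uT']
      have "x \<noteq> 0" using x(1) absolute_value_zero[OF v] by auto
      have eq: "s r = x ^ r * inverse (1 + x ^ r)" for r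
      proof -
        have "1 + x ^ r \<noteq> 0"
        proof (cases "r = 0")
          case False
          have "1 + x ^ r = 0 \<Longrightarrow> x ^ r = -1" by (simp add: eq_neg_iff_add_eq_0 add.commute)
          hence "1 + x ^ r = 0 \<Longrightarrow> v x ^ r = 1"
            by (metis absolute_value_power[OF v] absolute_value_minus[OF v] absolute_value_one[OF v])
          thus ?thesis using one_less_power[OF x(1), of r] False by fastforce
        qed simp
        thus ?thesis using \<open>x \<noteq> 0\<close> by (simp add: s_def field_simps)
      qed
      have l0: "(\<lambda>r. u (x ^ r)) \<longlonglongrightarrow> 0" using pow0[OF uT'] by (simp add: absolute_value_power[OF u])
      from tendsto_mult[OF l0 tendsto_inverse[OF absolute_value_tendsto_1[OF u l0]]] show ?thesis
        by (simp add: eq absolute_value_inverse[OF u] absolute_value_mult[OF u])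
    qed
    have "\<forall>\<^sub>F r in sequentially. 1 < v (s r * y)"
      using order_tendstoD(1)[OF tendsto_mult[OF lim1[OF v x(1)] tendsto_const[of "v y"]], of 1] y(1)
      by (simp add: absolute_value_mult[OF v])
    moreover have "\<forall>\<^sub>F r in sequentially. w (s r * y) < 1"
      using order_tendstoD(2)[OF tendsto_mult[OF lim1[OF w wx] tendsto_const[of "w y"]], of 1] y(2)
      by (simp add: absolute_value_mult[OF w])
    moreover have "\<forall>\<^sub>F r in sequentially. u (s r * y) < 1" if "u \<in> T" for u
      using order_tendstoD(2)[OF tendsto_mult[OF lim0[OF that] tendsto_const[of "u y"]], of 1]
      by (simp add: absolute_value_mult[OF uT[OF that]])
    hence "\<forall>\<^sub>F r in sequentially. \<forall>u\<in>T. u (s r * y) < 1"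
      using insert.hyps(1) by (simp add: eventually_ball_finite)
    ultimately have "\<forall>\<^sub>F r in sequentially. 1 < v (s r * y) \<and> w (s r * y) < 1 \<and> (\<forall>u\<in>T. u (s r * y) < 1)"
      by eventually_elim simp
    from eventually_happens'[OF sequentially_bot this] show ?thesis by auto
  qed
qed

lemma number_field_finite_basis:
  obtains B :: "'k :: number_field set"
  where "finite B" "rat_vs.independent B" "rat_vs.span B = UNIV"
proof -
  obtain S :: "'k set" where S: "finite S" "\<And>x. \<exists>c. x = (\<Sum>b\<in>S. of_rat (c b) * b)"
    using finite_over_rat by blast
  have "x \<in> rat_vs.span S" for x
  proof -
    obtain c where x: "x = (\<Sum>b\<in>S. rat_scale (c b) b)" using S(2) by (auto simp: rat_scale_def)
    show ?thesis unfolding x by (intro rat_vs.span_sum rat_vs.span_scale rat_vs.span_base)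
  qed
  hence S': "rat_vs.span S = UNIV" by auto
  obtain B where B: "B \<subseteq> S" "rat_vs.independent B" "S \<subseteq> rat_vs.span B"
    by (rule rat_vs.maximal_independent_subset)
  hence "rat_vs.span B = UNIV" using S' rat_vs.span_minimal[OF B(3) rat_vs.subspace_span] by auto
  thus ?thesis using that B S(1) finite_subset by blast
qed

text \<open>
  Weak approximation provides for every \<open>v \<in> S\<close> an element \<open>z v\<close> that is at least \<open>1\<close> under \<open>v\<close>
  and less than \<open>1 / card S\<close> under the other members of \<open>S\<close>. These elements are linearly
  independent over \<open>\<rat>\<close>: all members of \<open>S\<close> agree on the coefficients of a relation, and under
  the \<open>v\<close> that belongs to a coefficient of largest absolute value its term exceeds the sum of
  the others.
\<close>

lemma card_absolute_values_le:
  fixes S :: "('k :: number_field \<Rightarrow> real) set"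
  assumes "finite S" and S: "\<And>v. v \<in> S \<Longrightarrow> absolute_value v"
    and f: "\<And>v q. v \<in> S \<Longrightarrow> v (of_rat q) = f q"
    and a: "0 < f a" "f a < 1"
    and B: "finite B" "rat_vs.span B = (UNIV :: 'k set)"
  shows "card S \<le> card B"
proof -
  have "\<forall>v\<in>S. \<exists>x. 1 < v x \<and> (\<forall>w\<in>S - {v}. w x < 1)"
  proof
    fix v assume v: "v \<in> S"
    show "\<exists>x. 1 < v x \<and> (\<forall>w\<in>S - {v}. w x < 1)"
    proof (rule weak_approximation[of _ v a])
      show "v (of_rat q) = w (of_rat q)" if "w \<in> S - {v}" for w q
        using f[OF v] f[of w] that by simp
    qed (use \<open>finite S\<close> v S f[OF v] a in auto)
  qed
  then obtain x where "\<forall>v\<in>S. 1 < v (x v) \<and> (\<forall>w\<in>S - {v}. w (x v) < 1)"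
    by (rule bchoice[THEN exE])
  hence x: "\<And>v. v \<in> S \<Longrightarrow> 1 < v (x v)"
    "\<And>v w. v \<in> S \<Longrightarrow> w \<in> S \<Longrightarrow> w \<noteq> v \<Longrightarrow> w (x v) < 1" by auto
  have "\<forall>\<^sub>F r in sequentially. \<forall>v\<in>S. \<forall>w\<in>S. w \<noteq> v \<longrightarrow> w (x v) ^ r < inverse (card S)"
  proof -
    have "\<forall>\<^sub>F r in sequentially. w \<noteq> v \<longrightarrow> w (x v) ^ r < inverse (card S)" if "v \<in> S" "w \<in> S" for v w
    proof (cases "w = v")
      case False
      have "card S > 0" using that \<open>finite S\<close> by (auto simp: card_gt_0_iff)
      moreover have "(\<lambda>r. w (x v) ^ r) \<longlonglongrightarrow> 0"
        using x(2)[OF that False] absolute_value_nonneg[OF S[OF that(2)]]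
        by (intro LIMSEQ_realpow_zero) auto
      ultimately have "\<forall>\<^sub>F r in sequentially. w (x v) ^ r < inverse (card S)"
        by (intro order_tendstoD) auto
      thus ?thesis by eventually_elim simp
    qed simp
    thus ?thesis using \<open>finite S\<close> by (simp add: eventually_ball_finite)
  qed
  then obtain r where r: "\<And>v w. v \<in> S \<Longrightarrow> w \<in> S \<Longrightarrow> w \<noteq> v \<Longrightarrow> w (x v) ^ r < inverse (card S)"
    using eventually_happens'[OF sequentially_bot] by blast
  define z where "z v = x v ^ r" for v
  have z1: "1 \<le> v (z v)" if "v \<in> S" for v
    using x(1)[OF that] by (simp add: z_def absolute_value_power[OF S[OF that]])
  have z2: "w (z v) < inverse (card S)" if "v \<in> S" "w \<in> S" "w \<noteq> v" for v w
    using r[OF that] by (simp add: z_def absolute_value_power[OF S[OF that(2)]])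
  have inv1: "inverse (real (card S)) \<le> 1" if "v \<in> S" for v
    using that \<open>finite S\<close> by (auto simp: inverse_le_1_iff card_gt_0_iff Suc_le_eq)
  have inj: "inj_on z S"
  proof (rule inj_onI, rule ccontr)
    fix v w assume "v \<in> S" "w \<in> S" "z v = z w" "v \<noteq> w"
    thus False using z1[of v] z2[of w v] inv1[of v] by simp
  qed
  have "rat_vs.independent (z ` S)"
  proof
    assume "rat_vs.dependent (z ` S)"
    then obtain c where c: "\<exists>x\<in>z ` S. c x \<noteq> 0" "(\<Sum>x\<in>z ` S. rat_scale (c x) x) = 0"
      using \<open>finite S\<close> by (subst (asm) rat_vs.dependent_finite) auto
    define q where "q v = c (z v)" for v
    have q0: "(\<Sum>v\<in>S. of_rat (q v) * z v) = 0"
      using c(2) by (simp add: sum.reindex[OF inj] rat_scale_def q_def)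
    obtain v0 where v0: "v0 \<in> S" "q v0 \<noteq> 0" using c(1) by (auto simp: q_def)
    have "finite ((\<lambda>v. f (q v)) ` S)" "(\<lambda>v. f (q v)) ` S \<noteq> {}" using \<open>finite S\<close> v0 by auto
    from Max_in[OF this] obtain v where v: "v \<in> S" "f (q v) = Max ((\<lambda>v. f (q v)) ` S)" by auto
    have le: "f (q w) \<le> f (q v)" if "w \<in> S" for w using v that \<open>finite S\<close> by simp
    note av = S[OF v(1)]
    have "0 < f (q v0)" using absolute_value_pos[OF av, of "of_rat (q v0)"] f[OF v(1)] v0 by simp
    hence pos: "0 < f (q v)" using le[OF v0(1)] by linarith
    have "of_rat (q v) * z v = - (\<Sum>w\<in>S - {v}. of_rat (q w) * z w)"
      using q0 \<open>finite S\<close> v(1) by (simp add: sum.remove eq_neg_iff_add_eq_0)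
    hence "v (of_rat (q v) * z v) = v (\<Sum>w\<in>S - {v}. of_rat (q w) * z w)"
      using absolute_value_minus[OF av] by simp
    hence "f (q v) * v (z v) = v (\<Sum>w\<in>S - {v}. of_rat (q w) * z w)"
      by (simp add: absolute_value_mult[OF av] f[OF v(1)])
    also have "\<dots> \<le> (\<Sum>w\<in>S - {v}. f (q w) * v (z w))"
      using absolute_value_sum[OF av, of "\<lambda>w. of_rat (q w) * z w" "S - {v}"]
      by (simp add: absolute_value_mult[OF av] f[OF v(1)])
    also have "\<dots> \<le> (\<Sum>w\<in>S - {v}. f (q v) * inverse (card S))"
      using le z2[OF _ v(1)] pos absolute_value_nonneg[OF av]
      by (intro sum_mono mult_mono) (auto intro: less_imp_le)
    also have "\<dots> = f (q v) * ((card S - 1) / card S)"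
      using \<open>finite S\<close> v(1) by (simp add: divide_inverse)
    also have "\<dots> < f (q v) * 1"
    proof -
      have "card S > 0" using \<open>finite S\<close> v(1) by (auto simp: card_gt_0_iff)
      thus ?thesis using pos by (intro mult_strict_left_mono) (auto simp: field_simps)
    qed
    also have "\<dots> \<le> f (q v) * v (z v)" using z1[OF v(1)] pos by (intro mult_left_mono) auto
    finally show False by simp
  qed
  hence "card (z ` S) \<le> card B" using rat_vs.independent_span_bound[of B "z ` S"] B by auto
  thus ?thesis by (simp add: card_image[OF inj])
qed

lemma finite_absolute_values_above:
  assumes "0 < f a" "f a < (1 :: real)"
  shows "finite {v :: 'k :: number_field \<Rightarrow> real. absolute_value v \<and> (\<forall>q. v (of_rat q) = f q)}"
    (is "finite ?A")
proof (rule ccontr)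
  assume inf: "infinite ?A"
  obtain B :: "'k set" where B: "finite B" "rat_vs.span B = UNIV"
    by (rule number_field_finite_basis)
  obtain S where S: "S \<subseteq> ?A" "finite S" "card S = Suc (card B)"
    using infinite_arbitrarily_large[OF inf] by blast
  have "card S \<le> card B"
    using S(1) by (intro card_absolute_values_le[of S f a B] S(2) assms B) auto
  thus False using S(3) by simp
qed

section \<open>Finiteness of the nontrivial local factors\<close>

lemma padic_abs_le_1:
  assumes "prime p" "\<not> int p dvd snd (quotient_of q)"
  shows "padic_abs p q \<le> 1"
proof -
  have "multiplicity (int p) (snd (quotient_of q)) = 0"
    using assms(2) by (rule not_dvd_imp_multiplicity_0)
  moreover have "real p powi (- int k) \<le> 1" for k
    using prime_gt_0_nat[OF assms(1)] by (simp add: power_int_minus inverse_le_1_iff Suc_le_eq)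
  ultimately show ?thesis by (simp add: padic_abs_def)
qed

lemma padic_abs_prime:
  assumes "prime p"
  shows "padic_abs p (of_nat p) = inverse (real p)"
proof -
  have "quotient_of (of_nat p) = (int p, 1)" using quotient_of_int[of "int p"] by simp
  thus ?thesis using assms by (simp add: padic_abs_def power_int_minus)
qed

text \<open>
  Applied to \<open>(x + y) ^ n\<close>, the triangle inequality loses a factor of at most \<open>n + 1\<close>, which is
  negligible against the \<open>n\<close>-th power of a ratio greater than \<open>1\<close>.
\<close>

lemma nonarchimedean_ultrametric:
  assumes v: "absolute_value v" and le1: "\<And>n. v (of_nat n) \<le> 1"
    and M: "v x \<le> M" "v y \<le> M"
  shows "v (x + y) \<le> M"
proof (rule ccontr)
  assume "\<not> ?thesis"
  hence R: "M < v (x + y)" by simp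
  have M0: "0 \<le> M" using M(1) absolute_value_nonneg[OF v, of x] by linarith
  define c where "c = M / v (x + y)"
  have c: "0 \<le> c" "c < 1" using M0 R by (auto simp: c_def)
  \<comment> \<open>In the binomial expansion of \<open>(x + y)\<^sup>n\<close> every term has absolute value at most \<open>M\<^sup>n\<close>.\<close>
  have "v (x + y) ^ n \<le> real (n + 1) * M ^ n" for n
  proof -
    have "v (x + y) ^ n = v (\<Sum>k\<le>n. of_nat (n choose k) * x ^ k * y ^ (n - k))"
      by (simp add: absolute_value_power[OF v, symmetric] binomial_ring)
    also have "\<dots> \<le> (\<Sum>k\<le>n. v (of_nat (n choose k)) * v x ^ k * v y ^ (n - k))"
      using absolute_value_sum[OF v, of "\<lambda>k. of_nat (n choose k) * x ^ k * y ^ (n - k)"]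
      by (simp add: absolute_value_mult[OF v] absolute_value_power[OF v])
    also have "\<dots> \<le> (\<Sum>k\<le>n. 1 * M ^ k * M ^ (n - k))"
      using le1 M M0 absolute_value_nonneg[OF v]
      by (intro sum_mono mult_mono power_mono) (auto intro!: mult_nonneg_nonneg)
    also have "\<dots> = real (n + 1) * M ^ n" by (simp add: power_add[symmetric])
    finally show ?thesis .
  qed
  hence "1 \<le> real n * c ^ n + c ^ n" for n
    using R M0 by (simp add: c_def power_divide field_simps)
  moreover have "(\<lambda>n. real n * c ^ n + c ^ n) \<longlonglongrightarrow> 0 + 0"
    using c by (intro tendsto_add powser_times_n_limit_0 LIMSEQ_realpow_zero) auto
  ultimately have "1 \<le> 0 + (0 :: real)" by (intro LIMSEQ_le_const) auto
  thus False by simp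
qed

lemma nonarchimedean_sum_le:
  assumes v: "absolute_value v" and le1: "\<And>n. v (of_nat n) \<le> 1" and "0 \<le> M"
    and "\<And>i. i \<in> I \<Longrightarrow> v (f i) \<le> M"
  shows "v (\<Sum>i\<in>I. f i) \<le> M"
  using assms(4)
  by (induction I rule: infinite_finite_induct)
    (auto simp: absolute_value_zero[OF v] \<open>0 \<le> M\<close> intro!: nonarchimedean_ultrametric[OF v le1])

definition lies_over :: "('k :: number_field \<Rightarrow> real) \<Rightarrow> nat \<Rightarrow> bool" where
  "lies_over v p \<longleftrightarrow> absolute_value v \<and> prime p \<and> (\<forall>q. v (of_rat q) = padic_abs p q)"

text \<open>
  The set \<open>D\<close> consists of the primes in the denominators of a rational matrix of multiplication
  by \<open>x\<close>. Above any other prime the entries have absolute value at most \<open>1\<close>, so that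
  multiplication by \<open>x\<close> does not enlarge the largest absolute value of a spanning vector.
\<close>

lemma finitely_many_primes_large:
  fixes x :: "'k :: number_field"
  obtains D where "finite D" "\<And>v p. lies_over v p \<Longrightarrow> p \<notin> D \<Longrightarrow> v x \<le> 1"
proof -
  obtain B :: "'k set" where B: "finite B" "\<And>x. \<exists>c. x = (\<Sum>b\<in>B. of_rat (c b) * b)"
    using finite_over_rat by blast
  have "\<forall>b. \<exists>c. x * b = (\<Sum>b'\<in>B. of_rat (c b') * b')" using B(2) by blast
  then obtain c where c: "\<And>b. x * b = (\<Sum>b'\<in>B. of_rat (c b b') * b')" by metis
  define D where "D = (\<Union>b\<in>B. \<Union>b'\<in>B. {p. prime p \<and> int p dvd snd (quotient_of (c b b'))})"
  have "finite {p. prime p \<and> int p dvd snd (quotient_of q)}" for q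
  proof -
    have pos: "snd (quotient_of q) > 0" using quotient_of_denom_pos' by blast
    hence "{p. prime p \<and> int p dvd snd (quotient_of q)} \<subseteq> {..nat (snd (quotient_of q))}"
      by (auto dest!: zdvd_imp_le)
    thus ?thesis using finite_subset by blast
  qed
  hence "finite D" using B(1) by (auto simp: D_def)
  moreover have "v x \<le> 1"
    if "lies_over v p" and "p \<notin> D" for v p
  proof -
    have v: "absolute_value v" and p: "prime p" and vp: "\<And>q. v (of_rat q) = padic_abs p q"
      using \<open>lies_over v p\<close> by (simp_all add: lies_over_def)
    have le1: "v (of_nat n) \<le> 1" for n
    proof -
      have "quotient_of (of_nat n) = (int n, 1)" using quotient_of_int[of "int n"] by simp
      hence "padic_abs p (of_nat n) \<le> 1" using p by (intro padic_abs_le_1) auto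
      thus ?thesis using vp[of "of_nat n"] by simp
    qed
    have "B \<noteq> {}" using B(2)[of 1] by auto
    have ne: "v ` B \<noteq> {}" "finite (v ` B)" using \<open>B \<noteq> {}\<close> B(1) by auto
    from Max_in[OF ne(2,1)] obtain b where b: "b \<in> B" "v b = Max (v ` B)" by auto
    have max: "v b' \<le> v b" if "b' \<in> B" for b' using that b ne by simp
    have "\<exists>b'\<in>B. b' \<noteq> 0" using B(2)[of 1] by (metis (no_types, lifting) mult_zero_right sum.neutral zero_neq_one)
    then obtain b0 where b0: "b0 \<in> B" "b0 \<noteq> 0" by blast
    have pos: "v b > 0" using max[OF b0(1)] absolute_value_pos[OF v, of b0] b0(2) by linarith
    have "v x * v b = v (\<Sum>b'\<in>B. of_rat (c b b') * b')"
      by (simp add: c[symmetric] absolute_value_mult[OF v])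
    also have "\<dots> \<le> v b"
    proof (rule nonarchimedean_sum_le[OF v le1])
      fix b' assume b': "b' \<in> B"
      have "v (of_rat (c b b')) \<le> 1"
        using \<open>p \<notin> D\<close> b(1) b' p by (auto simp: vp D_def intro!: padic_abs_le_1)
      hence "v (of_rat (c b b')) * v b' \<le> 1 * v b"
        using max[OF b'] absolute_value_nonneg[OF v] by (intro mult_mono) auto
      thus "v (of_rat (c b b') * b') \<le> v b" by (simp add: absolute_value_mult[OF v])
    qed (use pos in auto)
    finally show ?thesis using pos by simp
  qed
  ultimately show ?thesis by (rule that)
qed

lemma finitely_many_primes_nontrivial:
  fixes x :: "'k :: number_field"
  assumes "x \<noteq> 0"
  obtains D where "finite D" "\<And>v p. lies_over v p \<Longrightarrow> p \<notin> D \<Longrightarrow> v x = 1"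
proof -
  obtain D1 where D1: "finite D1" "\<And>v p. lies_over v p \<Longrightarrow> p \<notin> D1 \<Longrightarrow> v x \<le> 1"
    by (rule finitely_many_primes_large[of x]) blast
  obtain D2 where D2: "finite D2" "\<And>v p. lies_over v p \<Longrightarrow> p \<notin> D2 \<Longrightarrow> v (inverse x) \<le> 1"
    by (rule finitely_many_primes_large[of "inverse x"]) blast
  have "v x = 1" if "lies_over v p" "p \<notin> D1 \<union> D2" for v p
  proof -
    have v: "absolute_value v" using that(1) by (simp add: lies_over_def)
    have "v x \<le> 1" "v (inverse x) \<le> 1" using D1(2)[OF that(1)] D2(2)[OF that(1)] that(2) by auto
    thus ?thesis using absolute_value_pos[OF v, of x] assms
      by (auto simp: absolute_value_inverse[OF v] inverse_le_1_iff)
  qed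
  thus ?thesis using D1(1) D2(1) by (intro that[of "D1 \<union> D2"]) auto
qed

lemma places_absolute_value:
  assumes "v \<in> places"
  shows "absolute_value v"
  using assms by (auto simp: places_def archimedean_place_def nonarchimedean_place_def)

text \<open>
  Above almost all primes every coordinate of \<open>x\<close> has absolute value \<open>0\<close> or \<open>1\<close>; above each of
  the remaining primes, and above the archimedean absolute value of \<open>\<rat>\<close>, there are only
  finitely many places.
\<close>

lemma finite_nontrivial_places:
  fixes x :: "'i \<Rightarrow> 'k :: number_field"
  assumes "finite I" and "\<exists>i\<in>I. x i \<noteq> 0"
  shows "finite {v \<in> places. archimedean_place v \<or> max_abs v I x \<noteq> 1}"
proof -
  define lying_over where "lying_over f = {v :: 'k \<Rightarrow> real. absolute_value v \<and> (\<forall>q. v (of_rat q) = f q)}" for f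
  have "\<exists>D. x i \<noteq> 0 \<longrightarrow> finite D \<and> (\<forall>v p. lies_over v p \<longrightarrow> p \<notin> D \<longrightarrow> v (x i) = 1)" for i
  proof (cases "x i = 0")
    case False
    then obtain D where "finite D" "\<And>v p. lies_over v p \<Longrightarrow> p \<notin> D \<Longrightarrow> v (x i) = 1"
      by (rule finitely_many_primes_nontrivial) blast
    thus ?thesis by blast
  qed simp
  hence "\<forall>i. \<exists>D. x i \<noteq> 0 \<longrightarrow> finite D \<and> (\<forall>v p. lies_over v p \<longrightarrow> p \<notin> D \<longrightarrow> v (x i) = 1)" by blast
  then obtain D where "\<forall>i. x i \<noteq> 0 \<longrightarrow> finite (D i) \<and> (\<forall>v p. lies_over v p \<longrightarrow> p \<notin> D i \<longrightarrow> v (x i) = 1)"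
    by (rule choice[THEN exE])
  hence D: "\<And>i. x i \<noteq> 0 \<Longrightarrow> finite (D i)"
    "\<And>i v p. x i \<noteq> 0 \<Longrightarrow> lies_over v p \<Longrightarrow> p \<notin> D i \<Longrightarrow> v (x i) = 1" by auto
  define P where "P = {p. prime p \<and> (\<exists>i\<in>I. x i \<noteq> 0 \<and> p \<in> D i)}"
  have "P \<subseteq> (\<Union>i\<in>{i\<in>I. x i \<noteq> 0}. D i)" by (auto simp: P_def)
  hence "finite P" using assms(1) D(1) by (elim finite_subset) auto
  moreover have "finite (lying_over (padic_abs p))" if "prime p" for p
    unfolding lying_over_def using prime_gt_1_nat[OF that]
    by (intro finite_absolute_values_above[of _ "of_nat p"]) (auto simp: padic_abs_prime[OF that] inverse_less_1_iff)
  moreover have "finite (lying_over (\<lambda>q. \<bar>real_of_rat q\<bar>))"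
    unfolding lying_over_def by (intro finite_absolute_values_above[of _ "1/2"]) (auto simp: of_rat_divide)
  ultimately have "finite (lying_over (\<lambda>q. \<bar>real_of_rat q\<bar>) \<union> (\<Union>p\<in>P. lying_over (padic_abs p)))"
    by (auto simp: P_def)
  moreover have "{v \<in> places. archimedean_place v \<or> max_abs v I x \<noteq> 1}
      \<subseteq> lying_over (\<lambda>q. \<bar>real_of_rat q\<bar>) \<union> (\<Union>p\<in>P. lying_over (padic_abs p))"
  proof
    fix v :: "'k \<Rightarrow> real" assume v: "v \<in> {v \<in> places. archimedean_place v \<or> max_abs v I x \<noteq> 1}"
    show "v \<in> lying_over (\<lambda>q. \<bar>real_of_rat q\<bar>) \<union> (\<Union>p\<in>P. lying_over (padic_abs p))"
    proof (cases "archimedean_place v")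
      case True
      thus ?thesis by (auto simp: lying_over_def archimedean_place_def)
    next
      case False
      then obtain p where vp: "lies_over v p"
        using v by (auto simp: places_def nonarchimedean_place_def lies_over_def)
      hence av: "absolute_value v" and "prime p" by (simp_all add: lies_over_def)
      have "p \<in> P"
      proof (rule ccontr)
        assume "p \<notin> P"
        hence 1: "v (x i) = 1" if "i \<in> I" "x i \<noteq> 0" for i
          using D(2)[OF that(2) vp] that \<open>prime p\<close> by (auto simp: P_def)
        have "max_abs v I x = 1"
          unfolding max_abs_def
        proof (rule Max_eqI)
          show "finite ((\<lambda>i. v (x i)) ` I)" using assms(1) by simp
          show "y \<le> 1" if "y \<in> (\<lambda>i. v (x i)) ` I" for y
            using that 1 absolute_value_zero[OF av] by force
          show "1 \<in> (\<lambda>i. v (x i)) ` I" using assms(2) 1 by force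
        qed
        thus False using v False by simp
      qed
      thus ?thesis using vp by (auto simp: lying_over_def lies_over_def)
    qed
  qed
  ultimately show ?thesis by (rule finite_subset[rotated])
qed

lemma place_prod_nonneg:
  assumes "\<And>v. v \<in> places \<Longrightarrow> 0 \<le> f v"
  shows "0 \<le> place_prod f"
  using assms by (auto simp: place_prod_def intro!: prod_nonneg)

text \<open>
  If infinitely many factors of \<open>f\<close> differ from \<open>1\<close>, then \<open>place_prod f\<close> has its default value
  \<open>0\<close>, which is also a lower bound for the product of \<open>g\<close>.
\<close>

lemma place_prod_mono:
  fixes f g :: "('k :: number_field \<Rightarrow> real) \<Rightarrow> real"
  assumes fg: "\<And>v. v \<in> places \<Longrightarrow> 0 \<le> f v" "\<And>v. v \<in> places \<Longrightarrow> f v \<le> g v"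
    and g: "finite {v \<in> places. g v \<noteq> 1}"
  shows "place_prod f \<le> place_prod g"
proof (cases "finite {v \<in> places. f v \<noteq> 1}")
  case True
  let ?S = "{v \<in> places. f v \<noteq> 1} \<union> {v \<in> places. g v \<noteq> 1}"
  have "place_prod f = (\<Prod>v\<in>?S. f v)"
    unfolding place_prod_def using True g by (auto intro!: prod.mono_neutral_left)
  also have "\<dots> \<le> (\<Prod>v\<in>?S. g v)" using fg by (intro prod_mono) auto
  also have "\<dots> = place_prod g"
    unfolding place_prod_def using True g by (auto intro!: prod.mono_neutral_right)
  finally show ?thesis .
next
  case False
  have "0 \<le> place_prod g" using fg by (intro place_prod_nonneg) (auto intro: order_trans)
  thus ?thesis using False by (simp add: place_prod_def)
qed

text \<open>
  The comparison is made factor by factor. The nonzero coordinate of \<open>x\<close> ensures that the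
  product on the right is a genuine finite product instead of the default value \<open>0\<close>.
\<close>

lemma height_le_l2_height:
  fixes x :: "'i \<Rightarrow> 'k :: number_field" and y :: "'j \<Rightarrow> 'k"
  assumes I: "finite I" "\<exists>i\<in>I. x i \<noteq> 0" and J: "finite J" "J \<noteq> {}"
    and le: "\<And>v j. absolute_value v \<Longrightarrow> j \<in> J \<Longrightarrow> \<exists>i\<in>I. v (y j) \<le> v (x i)"
  shows "height J y \<le> l2_height I x"
proof -
  let ?norm = "\<lambda>v. if archimedean_place v then L2_set (\<lambda>i. v (x i)) I else max_abs v I x"
  have max0: "0 \<le> max_abs v J y" and max_le: "max_abs v J y \<le> ?norm v" if "v \<in> places" for v
  proof -
    note v = places_absolute_value[OF that]
    obtain j where j: "j \<in> J" using J by blast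
    have "0 \<le> v (y j)" by (rule absolute_value_nonneg[OF v])
    also have "\<dots> \<le> max_abs v J y" unfolding max_abs_def using J j by (intro Max_ge) auto
    finally show "0 \<le> max_abs v J y" .
    have "I \<noteq> {}" using I by blast
    have "v (x i) \<le> ?norm v" if "i \<in> I" for i
      using member_le_L2_set[OF I(1) that, of "\<lambda>i. v (x i)"] I(1) that by (simp add: max_abs_def)
    hence "v (y j) \<le> ?norm v" if "j \<in> J" for j
      using le[OF v that] order_trans by blast
    thus "max_abs v J y \<le> ?norm v"
      unfolding max_abs_def[of v J] using J by (intro Max.boundedI) auto
  qed
  have "{v \<in> places. ?norm v ^ local_degree v \<noteq> 1} \<subseteq> {v \<in> places. archimedean_place v \<or> max_abs v I x \<noteq> 1}"
    by auto
  hence "finite {v \<in> places. ?norm v ^ local_degree v \<noteq> 1}"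
    using finite_nontrivial_places[OF I] by (rule finite_subset)
  hence "place_prod (\<lambda>v. max_abs v J y ^ local_degree v) \<le> place_prod (\<lambda>v. ?norm v ^ local_degree v)"
    by (intro place_prod_mono power_mono[OF max_le max0] zero_le_power[OF max0])
  thus ?thesis
    unfolding height_def l2_height_def
    by (cases "nf_degree TYPE('k) = 0") (auto intro: real_root_le_mono)
qed

lemma l2_height_nonneg: "0 \<le> l2_height I x" if "finite I" "I \<noteq> {}"
proof -
  have "0 \<le> max_abs v I x" if "v \<in> places" for v
    using \<open>finite I\<close> \<open>I \<noteq> {}\<close> absolute_value_nonneg[OF places_absolute_value[OF that]]
    by (auto simp: max_abs_def Max_ge_iff)
  thus ?thesis unfolding l2_height_def
    by (intro real_root_ge_zero place_prod_nonneg) (auto simp: L2_set_nonneg)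
qed

section \<open>Algebraic integers and their traces\<close>

text \<open>
  The \<open>\<int>\<close>-module structure of a ring; \<open>int_mod.span S\<close> is the additive group generated by \<open>S\<close>.
\<close>

definition int_scale :: "int \<Rightarrow> 'a \<Rightarrow> 'a :: comm_ring_1" where
  "int_scale n x = of_int n * x"

interpretation int_mod: Modules.module "int_scale :: int \<Rightarrow> 'a \<Rightarrow> 'a :: comm_ring_1"
  by unfold_locales (simp_all add: int_scale_def algebra_simps)

lemma int_span_mult:
  assumes "\<And>s. s \<in> S \<Longrightarrow> z * s \<in> int_mod.span T" and "t \<in> int_mod.span S"
  shows "z * t \<in> int_mod.span T"
proof -
  have "z * int_scale c t = int_scale c (z * t)" for c t
    by (simp add: int_scale_def mult.left_commute)
  hence "int_mod.subspace {t. z * t \<in> int_mod.span T}"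
    unfolding int_mod.subspace_def
    by (auto simp: int_mod.span_zero distrib_left intro!: int_mod.span_add int_mod.span_scale)
  hence "int_mod.span S \<subseteq> {t. z * t \<in> int_mod.span T}"
    using assms(1) by (intro int_mod.span_minimal) auto
  thus ?thesis using assms(2) by blast
qed

text \<open>
  Multiplication by \<open>z\<close> acts on the members of \<open>S\<close> through an integer matrix. The vector of all
  members of \<open>S\<close> is an eigenvector of that matrix with eigenvalue \<open>z\<close>, so \<open>z\<close> is a root of its
  characteristic polynomial, which is monic with integer coefficients.
\<close>

lemma algebraic_int_if_stable_module:
  fixes z :: "'a :: field_char_0"
  assumes S: "finite S" and nz: "s0 \<in> S" "s0 \<noteq> 0"
    and stable: "\<And>s. s \<in> S \<Longrightarrow> z * s \<in> int_mod.span S"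
  shows "algebraic_int z"
proof -
  define n where "n = card S"
  obtain e where e: "bij_betw e {..<n} S"
    using ex_bij_betw_nat_finite[OF S] by (auto simp: n_def lessThan_atLeast0)
  have "\<exists>c :: 'a \<Rightarrow> int. z * s = (\<Sum>t\<in>S. of_int (c t) * t)" if "s \<in> S" for s
    using stable[OF that] by (auto simp: int_mod.span_finite[OF S] int_scale_def)
  hence "\<forall>s\<in>S. \<exists>c :: 'a \<Rightarrow> int. z * s = (\<Sum>t\<in>S. of_int (c t) * t)" by blast
  then obtain c :: "'a \<Rightarrow> 'a \<Rightarrow> int" where c: "\<forall>s\<in>S. z * s = (\<Sum>t\<in>S. of_int (c s t) * t)"
    by (rule bchoice[THEN exE])
  define A where "A = Matrix.mat n n (\<lambda>(i, j). c (e i) (e j))"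
  define v where "v = Matrix.vec n e"
  have A: "A \<in> carrier_mat n n" by (simp add: A_def)
  have A': "map_mat of_int A \<in> carrier_mat n n" using A by simp
  have "map_mat of_int A *\<^sub>v v = z \<cdot>\<^sub>v v"
  proof (rule eq_vecI)
    fix i assume "i < dim_vec (z \<cdot>\<^sub>v v)"
    hence i: "i < n" by (simp add: v_def)
    hence eS: "e i \<in> S" using e by (auto simp: bij_betw_def)
    have "vec_index (map_mat of_int A *\<^sub>v v) i = (\<Sum>j<n. of_int (c (e i) (e j)) * e j)"
      using i by (simp add: A_def v_def scalar_prod_def lessThan_atLeast0)
    also have "\<dots> = (\<Sum>t\<in>S. of_int (c (e i) t) * t)" by (rule sum.reindex_bij_betw[OF e])
    also have "\<dots> = z * e i" using c eS by simp
    finally show "vec_index (map_mat of_int A *\<^sub>v v) i = vec_index (z \<cdot>\<^sub>v v) i"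
      using i by (simp add: v_def)
  qed (simp add: A_def v_def)
  moreover have "v \<noteq> 0\<^sub>v n"
  proof
    assume v0: "v = 0\<^sub>v n"
    obtain i where i: "i < n" "e i = s0" using nz(1) e by (auto simp: bij_betw_def)
    have "vec_index v i = 0" using v0 i by simp
    thus False using i nz(2) by (simp add: v_def)
  qed
  ultimately have "eigenvalue (map_mat of_int A) z"
    unfolding eigenvalue_def eigenvector_def using A by (intro exI[of _ v]) (auto simp: v_def)
  hence "poly (char_poly (map_mat of_int A)) z = 0"
    using eigenvalue_root_char_poly[OF A'] by blast
  hence "poly (map_poly of_int (char_poly A)) z = 0"
    by (simp add: of_int_hom.char_poly_hom[OF A])
  moreover have "lead_coeff (char_poly A) = 1" using degree_monic_char_poly[OF A] by simp
  ultimately show ?thesis unfolding algebraic_int_altdef_ipoly by blast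
qed

lemma algebraic_int_power_in_span:
  fixes x :: "'a :: field_char_0"
  assumes "algebraic_int x"
  obtains n where "x ^ n \<in> int_mod.span ((\<lambda>i. x ^ i) ` {..<n})"
proof -
  obtain p :: "int poly" where p: "poly (map_poly of_int p) x = 0" "lead_coeff p = 1"
    using assms unfolding algebraic_int_altdef_ipoly by blast
  define n where "n = Polynomial.degree p"
  have "0 = (\<Sum>i\<le>n. of_int (Polynomial.coeff p i) * x ^ i)"
    using p(1) by (simp add: poly_altdef n_def degree_map_poly coeff_map_poly)
  also have "\<dots> = (\<Sum>i<n. of_int (Polynomial.coeff p i) * x ^ i) + x ^ n"
    using p(2) by (simp add: n_def lessThan_Suc_atMost[symmetric])
  finally have "x ^ n = (\<Sum>i<n. int_scale (- Polynomial.coeff p i) (x ^ i))"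
    by (simp add: int_scale_def sum_negf eq_neg_iff_add_eq_0 add.commute)
  also have "\<dots> \<in> int_mod.span ((\<lambda>i. x ^ i) ` {..<n})"
    by (intro int_mod.span_sum int_mod.span_scale int_mod.span_base) auto
  finally show ?thesis by (rule that)
qed

lemma int_span_power_shift:
  assumes n: "x ^ n \<in> int_mod.span ((\<lambda>i. x ^ i) ` {..<n})"
    and S: "\<And>i. i < n \<Longrightarrow> x ^ i * w \<in> S" and i: "i < n"
  shows "x * (x ^ i * w) \<in> int_mod.span S"
proof (cases "Suc i < n")
  case True
  thus ?thesis using int_mod.span_base[OF S[OF True]] by (simp add: mult.assoc)
next
  case False
  hence i: "Suc i = n" using i by simp
  have "w * x ^ n \<in> int_mod.span S"
    using S by (intro int_span_mult[OF _ n]) (auto simp: mult.commute intro!: int_mod.span_base)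
  thus ?thesis by (simp add: i[symmetric] mult_ac)
qed

text \<open>
  The products \<open>x ^ i * y ^ j\<close>, with exponents below the degrees of monic equations of \<open>x\<close> and
  \<open>y\<close>, generate a module that is stable under multiplication by \<open>x\<close> and by \<open>y\<close>.
\<close>

lemma algebraic_int_ring:
  fixes x y :: "'a :: field_char_0"
  assumes "algebraic_int x" "algebraic_int y"
  shows algebraic_int_add: "algebraic_int (x + y)" and algebraic_int_mult: "algebraic_int (x * y)"
proof -
  obtain n where n: "x ^ n \<in> int_mod.span ((\<lambda>i. x ^ i) ` {..<n})"
    by (rule algebraic_int_power_in_span[OF assms(1)])
  obtain m where m: "y ^ m \<in> int_mod.span ((\<lambda>i. y ^ i) ` {..<m})"
    by (rule algebraic_int_power_in_span[OF assms(2)])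
  have n0: "n \<noteq> 0" by (rule notI) (use n in \<open>simp\<close>)
  have m0: "m \<noteq> 0" by (rule notI) (use m in \<open>simp\<close>)
  define S where "S = (\<lambda>(i, j). x ^ i * y ^ j) ` ({..<n} \<times> {..<m})"
  have S: "finite S" "x ^ i * y ^ j \<in> S" if "i < n" "j < m" for i j
    using that by (auto simp: S_def)
  have fin: "finite S" by (simp add: S_def)
  have one: "1 \<in> S" using S(2)[of 0 0] n0 m0 by simp
  have xS: "x * s \<in> int_mod.span S" and yS: "y * s \<in> int_mod.span S" if "s \<in> S" for s
  proof -
    from that obtain i j where ij: "i < n" "j < m" "s = x ^ i * y ^ j" by (auto simp: S_def)
    show "x * s \<in> int_mod.span S"
      unfolding ij(3) using S(2) ij by (intro int_span_power_shift[OF n]) auto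
    have "y * (y ^ j * x ^ i) \<in> int_mod.span S"
      using S(2) ij by (intro int_span_power_shift[OF m]) (auto simp: mult.commute)
    thus "y * s \<in> int_mod.span S" by (simp add: ij(3) mult_ac)
  qed
  show "algebraic_int (x + y)"
    by (rule algebraic_int_if_stable_module[OF fin one])
      (auto simp: distrib_right intro!: int_mod.span_add xS yS)
  show "algebraic_int (x * y)"
    by (rule algebraic_int_if_stable_module[OF fin one])
      (auto simp: mult.assoc intro!: int_span_mult[OF xS] yS)
qed

lemma algebraic_int_sum:
  fixes f :: "'i \<Rightarrow> 'a :: field_char_0"
  assumes "\<And>i. i \<in> I \<Longrightarrow> algebraic_int (f i)"
  shows "algebraic_int (\<Sum>i\<in>I. f i)"
  using assms by (induction I rule: infinite_finite_induct) (auto intro: algebraic_int_add)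

lemma algebraic_int_of_int_mult:
  fixes x :: "'a :: field_char_0"
  shows "algebraic_int x \<Longrightarrow> algebraic_int (of_int n * x)"
  by (rule algebraic_int_mult[OF int_imp_algebraic_int[OF Ints_of_int]])

lemma common_denominator:
  fixes Q :: "rat set"
  assumes "finite Q"
  obtains N :: int where "N > 0" "\<And>q. q \<in> Q \<Longrightarrow> of_int N * q \<in> \<int>"
proof -
  have "\<exists>N :: int. N > 0 \<and> (\<forall>q\<in>Q. of_int N * q \<in> \<int>)"
    using assms
  proof (induction Q rule: finite_induct)
    case (insert q Q)
    then obtain N :: int where N: "N > 0" "\<forall>q\<in>Q. of_int N * q \<in> \<int>" by blast
    obtain a d where q: "quotient_of q = (a, d)" by (cases "quotient_of q")
    have d: "d > 0" using quotient_of_denom_pos[OF q] .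
    have "of_int (N * d) * q \<in> \<int>" using quotient_of_div[OF q] d by simp
    moreover have "of_int (N * d) * q' \<in> \<int>" if "q' \<in> Q" for q'
    proof -
      have "of_int d * (of_int N * q') \<in> \<int>" using N(2) that by (blast intro: Ints_mult[OF Ints_of_int])
      thus ?thesis by (simp add: mult_ac)
    qed
    ultimately show ?case using N(1) d by (intro exI[of _ "N * d"]) auto
  qed (auto intro: exI[of _ 1])
  thus ?thesis using that by blast
qed

text \<open>
  The integer \<open>N\<close> clears the denominators in a matrix of multiplication by \<open>x\<close>.
\<close>

lemma integral_multiple:
  fixes x :: "'k :: number_field"
  obtains N :: int where "N > 0" "algebraic_int (of_int N * x)"
proof -
  obtain B :: "'k set" where B: "finite B" "\<And>x. \<exists>c. x = (\<Sum>b\<in>B. of_rat (c b) * b)"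
    using finite_over_rat by blast
  have "\<forall>b. \<exists>c. x * b = (\<Sum>b'\<in>B. of_rat (c b') * b')" using B(2) by blast
  then obtain c where c: "\<forall>b. x * b = (\<Sum>b'\<in>B. of_rat (c b b') * b')" by (rule choice[THEN exE])
  obtain N :: int where N: "N > 0" "\<And>q. q \<in> (\<lambda>(b, b'). c b b') ` (B \<times> B) \<Longrightarrow> of_int N * q \<in> \<int>"
    by (rule common_denominator[of "(\<lambda>(b, b'). c b b') ` (B \<times> B)"]) (use B(1) in auto)
  have "\<exists>b\<in>B. b \<noteq> 0"
  proof (rule ccontr)
    assume "\<not> ?thesis"
    moreover obtain c :: "'k \<Rightarrow> rat" where "1 = (\<Sum>b\<in>B. of_rat (c b) * b)" using B(2) by blast
    ultimately show False by simp
  qed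
  then obtain b0 where b0: "b0 \<in> B" "b0 \<noteq> 0" by blast
  have "of_int N * x * b \<in> int_mod.span B" if b: "b \<in> B" for b
  proof -
    have "of_int N * x * b = (\<Sum>b'\<in>B. of_rat (of_int N * c b b') * b')"
      using c by (simp add: mult.assoc sum_distrib_left of_rat_mult)
    also have "\<dots> \<in> int_mod.span B"
    proof (rule int_mod.span_sum)
      fix b' assume b': "b' \<in> B"
      have "of_int N * c b b' \<in> \<int>" using b b' N(2) by auto
      then obtain k where "of_int N * c b b' = of_int k" by (auto elim: Ints_cases)
      hence "of_rat (of_int N * c b b') * b' = int_scale k b'" by (simp add: int_scale_def)
      thus "of_rat (of_int N * c b b') * b' \<in> int_mod.span B"
        using b' by (simp add: int_mod.span_scale int_mod.span_base)
    qed
    finally show ?thesis .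
  qed
  hence "algebraic_int (of_int N * x)"
    by (rule algebraic_int_if_stable_module[OF B(1) b0])
  thus ?thesis using N(1) that by blast
qed

lemma nf_trace_basis:
  obtains B :: "'k :: number_field set"
  where "finite B" "rat_vs.independent B" "rat_vs.span B = UNIV"
    "\<forall>x. nf_trace x = (\<Sum>b\<in>B. rat_vs.representation B (x * b) b)"
proof -
  obtain S :: "'k set" where S: "finite S" "rat_vs.independent S" "rat_vs.span S = UNIV"
    by (rule number_field_finite_basis)
  define B where "B = (SOME B :: 'k set. rat_vs.independent B \<and> rat_vs.span B = UNIV)"
  have "rat_vs.independent S \<and> rat_vs.span S = UNIV" using S(2,3) by (rule conjI)
  hence "rat_vs.independent B \<and> rat_vs.span B = UNIV" unfolding B_def by (rule someI)
  hence B: "rat_vs.independent B" "rat_vs.span B = UNIV" by simp_all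
  have fin: "finite B" using rat_vs.independent_span_bound[OF S(1) B(1)] S(3) by simp
  have "\<forall>x. nf_trace x = (\<Sum>b\<in>B. rat_vs.representation B (x * b) b)"
    by (simp only: nf_trace_def Let_def B_def[symmetric] simp_thms)
  from that[OF fin B this] show ?thesis .
qed

lemma nf_trace_linear:
  fixes x y :: "'k :: number_field"
  shows nf_trace_add: "nf_trace (x + y) = nf_trace x + nf_trace y"
    and nf_trace_scale: "nf_trace (of_rat q * x) = q * nf_trace x"
proof -
  obtain B :: "'k set" where B: "finite B" "rat_vs.independent B" "rat_vs.span B = UNIV"
    and tr: "\<forall>x. nf_trace x = (\<Sum>b\<in>B. rat_vs.representation B (x * b) b)"
    by (rule nf_trace_basis)
  have UN: "z \<in> rat_vs.span B" for z using B(3) by simp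
  show "nf_trace (x + y) = nf_trace x + nf_trace y"
    by (simp add: tr distrib_right rat_vs.representation_add[OF B(2) UN UN] sum.distrib)
  have "rat_vs.representation B (of_rat q * z) = (\<lambda>b. q * rat_vs.representation B z b)" for z
    using rat_vs.representation_scale[OF B(2) UN, of q z] by (simp add: rat_scale_def)
  thus "nf_trace (of_rat q * x) = q * nf_trace x"
    by (simp add: tr mult.assoc sum_distrib_left)
qed

lemma nf_trace_0 [simp]: "nf_trace 0 = 0"
  using nf_trace_scale[of 0 0] by simp

lemma nf_trace_sum: "nf_trace (\<Sum>i\<in>I. f i) = (\<Sum>i\<in>I. nf_trace (f i))"
  by (induction I rule: infinite_finite_induct) (simp_all add: nf_trace_add)

text \<open>
  The trace of \<open>1\<close> is the degree of the field.
\<close>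

lemma nf_trace_1: "nf_trace (1 :: 'k :: number_field) \<noteq> 0"
proof -
  obtain B :: "'k set" where B: "finite B" "rat_vs.independent B" "rat_vs.span B = UNIV"
    and tr: "\<forall>x. nf_trace x = (\<Sum>b\<in>B. rat_vs.representation B (x * b) b)"
    by (rule nf_trace_basis)
  have "B \<noteq> {}"
  proof
    assume "B = {}"
    hence UN: "(UNIV :: 'k set) = {0}" using B(3) by simp
    have "(1 :: 'k) \<in> {0}" by (subst UN[symmetric]) (rule UNIV_I)
    thus False by simp
  qed
  moreover have "nf_trace (1 :: 'k) = of_nat (card B)"
    by (simp add: tr rat_vs.representation_basis[OF B(2)])
  ultimately show ?thesis using B(1) by simp
qed

lemma trace_similar_mat:
  fixes A B :: "'a :: comm_ring_1 mat"
  assumes "similar_mat A B" and A: "A \<in> carrier_mat n n"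
  shows "(\<Sum>i<n. A $$ (i, i)) = (\<Sum>i<n. B $$ (i, i))"
proof -
  obtain P Q where wit: "similar_mat_wit A B P Q" using assms(1) unfolding similar_mat_def by blast
  have PQ: "P \<in> carrier_mat n n" "Q \<in> carrier_mat n n" "B \<in> carrier_mat n n" "Q * P = 1\<^sub>m n" "A = P * B * Q"
    using similar_mat_witD2[OF A wit] by auto
  have "(\<Sum>i<n. (X * Y) $$ (i, i)) = (\<Sum>i<n. (Y * X) $$ (i, i))"
    if "X \<in> carrier_mat n n" "Y \<in> carrier_mat n n" for X Y :: "'a mat"
  proof -
    have "(\<Sum>i<n. (X * Y) $$ (i, i)) = (\<Sum>i<n. \<Sum>j<n. X $$ (i, j) * Y $$ (j, i))"
      using that by (simp add: scalar_prod_def lessThan_atLeast0)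
    also have "\<dots> = (\<Sum>j<n. \<Sum>i<n. Y $$ (j, i) * X $$ (i, j))"
      by (subst sum.swap) (simp add: mult.commute)
    also have "\<dots> = (\<Sum>i<n. (Y * X) $$ (i, i))"
      using that by (simp add: scalar_prod_def lessThan_atLeast0)
    finally show ?thesis .
  qed
  from this[of "P * B" Q] have "(\<Sum>i<n. A $$ (i, i)) = (\<Sum>i<n. (Q * (P * B)) $$ (i, i))"
    unfolding PQ(5) using PQ(1-3) by simp
  also have "Q * (P * B) = Q * P * B" using PQ(1-3) by (intro assoc_mult_mat[symmetric])
  also have "\<dots> = B" using PQ(3,4) by simp
  finally show ?thesis .
qed

text \<open>
  Over the complex numbers the matrix of multiplication by \<open>x\<close> is similar to a triangular one,
  and its trace is the sum of the diagonal entries, which are eigenvalues. An eigenvector for the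
  eigenvalue \<open>l\<close> defines a nonzero \<open>\<rat>\<close>-linear map \<open>\<phi>\<close> from the field to the complex numbers
  with \<open>\<phi> (x * y) = l * \<phi> y\<close>. Hence every rational polynomial equation of \<open>x\<close> is satisfied by
  \<open>l\<close>, and \<open>l\<close> is an algebraic integer. Their sum is an algebraic integer and rational.
\<close>

lemma nf_trace_integral:
  fixes x :: "'k :: number_field"
  assumes "algebraic_int x"
  shows "nf_trace x \<in> \<int>"
proof -
  obtain B :: "'k set" where B: "finite B" "rat_vs.independent B" "rat_vs.span B = UNIV"
    and tr: "\<forall>x. nf_trace x = (\<Sum>b\<in>B. rat_vs.representation B (x * b) b)"
    by (rule nf_trace_basis)
  have UN: "z \<in> rat_vs.span B" for z using B(3) by simp
  let ?rep = "rat_vs.representation B"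
  define n where "n = card B"
  obtain e where e: "bij_betw e {..<n} B"
    using ex_bij_betw_nat_finite[OF B(1)] by (auto simp: n_def lessThan_atLeast0)
  have eB: "e i \<in> B" if "i < n" for i using e that by (auto simp: bij_betw_def)
  define M where "M = Matrix.mat n n (\<lambda>(i, j). of_rat (?rep (x * e i) (e j)) :: complex)"
  have M: "M \<in> carrier_mat n n" by (simp add: M_def)
  have trM: "of_rat (nf_trace x) = (\<Sum>i<n. M $$ (i, i))"
    by (simp add: tr M_def of_rat_sum sum.reindex_bij_betw[OF e, symmetric])
  obtain as where "char_poly M = (\<Prod>a\<leftarrow>as. [:- a, 1:])"
    using char_poly_factorized[OF M] by blast
  then obtain U where U: "U \<in> carrier_mat n n" "upper_triangular U" "similar_mat M U"
    using schur_decomposition_exists[OF M] by blast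
  have "algebraic_int (U $$ (i, i))" if i: "i < n" for i
  proof -
    let ?l = "U $$ (i, i)"
    have "?l \<in> set (diag_mat U)" using i U(1) by (auto simp: diag_mat_def)
    hence "poly (char_poly U) ?l = 0"
      by (auto simp: char_poly_upper_triangular[OF U(1,2)] poly_prod_list prod_list_zero_iff)
    hence "eigenvalue M ?l"
      using eigenvalue_root_char_poly[OF M] char_poly_similar[OF U(3)] by simp
    then obtain v where v: "v \<in> carrier_vec n" "v \<noteq> 0\<^sub>v n" "M *\<^sub>v v = ?l \<cdot>\<^sub>v v"
      using M by (auto simp: eigenvalue_def eigenvector_def)
    define \<phi> where "\<phi> y = (\<Sum>j<n. of_rat (?rep y (e j)) * vec_index v j)" for y
    have \<phi>_add: "\<phi> (y + z) = \<phi> y + \<phi> z" for y z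
      by (simp add: \<phi>_def rat_vs.representation_add[OF B(2) UN UN] of_rat_add distrib_right sum.distrib)
    have \<phi>_scale: "\<phi> (of_rat q * y) = of_rat q * \<phi> y" for q y
      using rat_vs.representation_scale[OF B(2) UN, of q y]
      by (simp add: \<phi>_def rat_scale_def of_rat_mult sum_distrib_left mult.assoc)
    have \<phi>_0: "\<phi> 0 = 0" using \<phi>_scale[of 0 0] by simp
    have \<phi>_sum: "\<phi> (\<Sum>i\<in>I. f i) = (\<Sum>i\<in>I. \<phi> (f i))" for I and f :: "nat \<Rightarrow> 'k"
      by (induction I rule: infinite_finite_induct) (simp_all add: \<phi>_0 \<phi>_add)
    have \<phi>_e: "\<phi> (e j) = vec_index v j" if "j < n" for j
    proof -
      have "\<phi> (e j) = (\<Sum>k<n. if k = j then vec_index v k else 0)"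
        unfolding \<phi>_def
      proof (rule sum.cong)
        fix k assume "k \<in> {..<n}"
        hence "e k = e j \<longleftrightarrow> k = j" using e that by (auto simp: bij_betw_def inj_on_def)
        thus "of_rat (?rep (e j) (e k)) * vec_index v k = (if k = j then vec_index v k else 0)"
          by (simp add: rat_vs.representation_basis[OF B(2) eB[OF that]])
      qed simp
      thus ?thesis using that by simp
    qed
    have \<phi>_xe: "\<phi> (x * e j) = ?l * vec_index v j" if "j < n" for j
    proof -
      have "\<phi> (x * e j) = vec_index (M *\<^sub>v v) j"
        using that v(1) by (simp add: \<phi>_def M_def scalar_prod_def lessThan_atLeast0)
      thus ?thesis using that v(1) unfolding v(3) by simp
    qed
    have expand: "y = (\<Sum>j<n. of_rat (?rep y (e j)) * e j)" for y
    proof -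
      have "y = (\<Sum>b\<in>B. of_rat (?rep y b) * b)"
        using rat_vs.sum_representation_eq[OF B(2) UN B(1) subset_refl, of y] by (simp add: rat_scale_def)
      also have "\<dots> = (\<Sum>j<n. of_rat (?rep y (e j)) * e j)"
        by (rule sum.reindex_bij_betw[OF e, symmetric])
      finally show ?thesis .
    qed
    have \<phi>_x: "\<phi> (x * y) = ?l * \<phi> y" for y
    proof -
      have "x * y = (\<Sum>j<n. of_rat (?rep y (e j)) * (x * e j))"
        using arg_cong[OF expand[of y], of "\<lambda>y. x * y"]
        by (simp add: sum_distrib_left mult.left_commute)
      hence "\<phi> (x * y) = (\<Sum>j<n. of_rat (?rep y (e j)) * (?l * vec_index v j))"
        by (simp add: \<phi>_sum \<phi>_scale \<phi>_xe)
      thus ?thesis by (simp add: \<phi>_def sum_distrib_left mult.left_commute)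
    qed
    have \<phi>_pow: "\<phi> (x ^ k * y) = ?l ^ k * \<phi> y" for k y
      by (induction k) (simp_all add: \<phi>_x mult.assoc)
    have "\<exists>j<n. vec_index v j \<noteq> 0"
    proof (rule ccontr)
      assume "\<not> ?thesis"
      hence "v = 0\<^sub>v n" using v(1) by (intro eq_vecI) auto
      thus False using v(2) by simp
    qed
    then obtain j where j: "j < n" "vec_index v j \<noteq> 0" by blast
    obtain p :: "int poly" where p: "poly (map_poly of_int p) x = 0" "lead_coeff p = 1"
      using assms unfolding algebraic_int_altdef_ipoly by blast
    have "poly (map_poly of_int p) ?l * vec_index v j
        = (\<Sum>k\<le>Polynomial.degree p. of_rat (of_int (Polynomial.coeff p k)) * \<phi> (x ^ k * e j))"
      using j(1) by (simp add: poly_altdef degree_map_poly coeff_map_poly \<phi>_pow \<phi>_e sum_distrib_right mult.assoc)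
    also have "\<dots> = \<phi> (\<Sum>k\<le>Polynomial.degree p. of_rat (of_int (Polynomial.coeff p k)) * (x ^ k * e j))"
      by (simp only: \<phi>_sum \<phi>_scale)
    also have "(\<Sum>k\<le>Polynomial.degree p. of_rat (of_int (Polynomial.coeff p k)) * (x ^ k * e j)) = poly (map_poly of_int p) x * e j"
      by (simp add: poly_altdef degree_map_poly coeff_map_poly sum_distrib_right mult.assoc)
    also have "\<phi> \<dots> = 0" by (simp add: p(1) \<phi>_0)
    finally have "poly (map_poly of_int p) ?l = 0" using j(2) by simp
    thus ?thesis using p(2) unfolding algebraic_int_altdef_ipoly by blast
  qed
  hence "algebraic_int (of_rat (nf_trace x) :: complex)"
    unfolding trM trace_similar_mat[OF U(3) M] by (intro algebraic_int_sum) auto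
  hence "(of_rat (nf_trace x) :: complex) \<in> \<int>"
    by (rule rational_algebraic_int_is_int) auto
  then obtain k where "of_rat (nf_trace x) = (of_int k :: complex)" by (auto elim: Ints_cases)
  hence "of_rat (nf_trace x) = (of_rat (of_int k) :: complex)" by simp
  hence "nf_trace x = of_int k" by (simp only: of_rat_eq_iff)
  thus ?thesis by simp
qed

section \<open>The discriminant\<close>

definition trace_matrix :: "'k :: number_field list \<Rightarrow> rat mat" where
  "trace_matrix ws = Matrix.mat (length ws) (length ws) (\<lambda>(i, j). nf_trace (ws ! i * ws ! j))"

text \<open>On integral bases this is the discriminant.\<close>

definition trace_det :: "'k :: number_field list \<Rightarrow> rat" where
  "trace_det ws = Determinant.det (trace_matrix ws)"

lemma trace_matrix_carrier [simp]: "trace_matrix ws \<in> carrier_mat (length ws) (length ws)"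
  by (simp add: trace_matrix_def)

lemma trace_matrix_mult_vec:
  fixes ws :: "'k :: number_field list"
  assumes "v \<in> carrier_vec (length ws)" "i < length ws"
  shows "vec_index (trace_matrix ws *\<^sub>v v) i
    = nf_trace (ws ! i * (\<Sum>j<length ws. of_rat (vec_index v j) * ws ! j))"
proof -
  have "vec_index (trace_matrix ws *\<^sub>v v) i = (\<Sum>j<length ws. vec_index v j * nf_trace (ws ! i * ws ! j))"
    using assms by (simp add: trace_matrix_def scalar_prod_def lessThan_atLeast0 mult.commute)
  also have "\<dots> = (\<Sum>j<length ws. nf_trace (of_rat (vec_index v j) * (ws ! i * ws ! j)))"
    by (simp only: nf_trace_scale)
  also have "\<dots> = nf_trace (ws ! i * (\<Sum>j<length ws. of_rat (vec_index v j) * ws ! j))"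
    by (simp only: nf_trace_sum[symmetric] sum_distrib_left mult.left_commute)
  finally show ?thesis .
qed

lemma (in vector_space) span_list_coeffs:
  assumes "x \<in> span (set ws)"
  shows "\<exists>c. x = (\<Sum>j<length ws. scale (c j) (ws ! j))"
proof -
  let ?L = "{x. \<exists>c. x = (\<Sum>j<length ws. scale (c j) (ws ! j))}"
  have "subspace ?L"
  proof (rule subspaceI)
    show "0 \<in> ?L" by (auto intro!: exI[of _ "\<lambda>_. 0"])
    show "x + y \<in> ?L" if x: "x \<in> ?L" and y: "y \<in> ?L" for x y
    proof -
      obtain c where c: "x = (\<Sum>j<length ws. scale (c j) (ws ! j))" using x by blast
      obtain d where d: "y = (\<Sum>j<length ws. scale (d j) (ws ! j))" using y by blast
      have "x + y = (\<Sum>j<length ws. scale (c j + d j) (ws ! j))"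
        by (simp add: c d scale_left_distrib sum.distrib)
      thus ?thesis by (intro CollectI exI)
    qed
    show "scale a x \<in> ?L" if x: "x \<in> ?L" for a x
    proof -
      obtain c where c: "x = (\<Sum>j<length ws. scale (c j) (ws ! j))" using x by blast
      have "scale a x = (\<Sum>j<length ws. scale (a * c j) (ws ! j))"
        by (simp add: c scale_sum_right)
      thus ?thesis by (intro CollectI exI)
    qed
  qed
  moreover have "set ws \<subseteq> ?L"
  proof
    fix w assume "w \<in> set ws"
    then obtain i where i: "i < length ws" "w = ws ! i" by (auto simp: in_set_conv_nth)
    have "(\<Sum>j<length ws. scale (if j = i then 1 else 0) (ws ! j)) = (\<Sum>j<length ws. if j = i then ws ! j else 0)"
      by (intro sum.cong) auto
    also have "\<dots> = w" using i by simp
    finally show "w \<in> ?L" by (intro CollectI exI[of _ "\<lambda>j. if j = i then 1 else 0"]) simp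
  qed
  ultimately have "span (set ws) \<subseteq> ?L" by (intro span_minimal)
  thus ?thesis using assms by blast
qed

lemma rat_span_list_coeffs:
  fixes x :: "'k :: number_field"
  assumes "rat_vs.span (set ws) = UNIV"
  obtains c where "x = (\<Sum>j<length ws. of_rat (c j) * ws ! j)"
  using rat_vs.span_list_coeffs[of x ws] assms by (auto simp: rat_scale_def)

text \<open>
  A vector in the kernel of the trace matrix gives an element \<open>y\<close> such that \<open>z * y\<close> has trace \<open>0\<close>
  for all \<open>z\<close>. If \<open>y\<close> were nonzero, \<open>z = inverse y\<close> would contradict \<open>nf_trace_1\<close>.
\<close>

lemma trace_det_nonzero:
  fixes ws :: "'k :: number_field list"
  assumes span: "rat_vs.span (set ws) = UNIV"
    and indep: "\<And>c j. (\<Sum>j<length ws. of_rat (c j) * ws ! j) = 0 \<Longrightarrow> j < length ws \<Longrightarrow> c j = 0"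
  shows "trace_det ws \<noteq> 0"
proof
  assume "trace_det ws = 0"
  then obtain v where v: "v \<in> carrier_vec (length ws)" "v \<noteq> 0\<^sub>v (length ws)"
    "trace_matrix ws *\<^sub>v v = 0\<^sub>v (length ws)"
    unfolding trace_det_def using det_0_iff_vec_prod_zero[OF trace_matrix_carrier[of ws]] by blast
  define y where "y = (\<Sum>j<length ws. of_rat (vec_index v j) * ws ! j)"
  have orth: "nf_trace (ws ! i * y) = 0" if "i < length ws" for i
    using trace_matrix_mult_vec[OF v(1) that] that by (simp add: v(3) y_def)
  have "nf_trace (z * y) = 0" for z
  proof -
    obtain c where c: "z = (\<Sum>j<length ws. of_rat (c j) * ws ! j)"
      by (rule rat_span_list_coeffs[OF span])
    have "nf_trace (z * y) = (\<Sum>j<length ws. c j * nf_trace (ws ! j * y))"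
      by (simp add: c sum_distrib_right nf_trace_sum mult.assoc nf_trace_scale)
    thus ?thesis using orth by simp
  qed
  from this[of "inverse y"] have "y = 0" using nf_trace_1[where 'k = 'k] by (cases "y = 0") auto
  hence "vec_index v j = 0" if "j < length ws" for j
    using indep[of "vec_index v" j] that by (simp add: y_def)
  hence "v = 0\<^sub>v (length ws)" using v(1) by (intro eq_vecI) auto
  thus False using v(2) by simp
qed

text \<open>
  The coefficients of a linear relation among \<open>ws\<close> form a vector in the kernel of the trace
  matrix.
\<close>

lemma trace_det_nonzero_independent:
  fixes ws :: "'k :: number_field list"
  assumes "trace_det ws \<noteq> 0"
    and "(\<Sum>j<length ws. of_rat (c j) * ws ! j) = 0" and "j < length ws"
  shows "c j = 0"
proof -
  let ?v = "Matrix.vec (length ws) c"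
  have sum: "(\<Sum>j<length ws. of_rat (vec_index ?v j) * ws ! j) = 0" using assms(2) by simp
  have "trace_matrix ws *\<^sub>v ?v = 0\<^sub>v (length ws)"
  proof (rule eq_vecI)
    fix i assume "i < dim_vec (0\<^sub>v (length ws) :: rat Matrix.vec)"
    hence i: "i < length ws" by simp
    have "vec_index (trace_matrix ws *\<^sub>v ?v) i = nf_trace (ws ! i * 0)"
      unfolding sum[symmetric] by (rule trace_matrix_mult_vec[OF _ i]) simp
    thus "vec_index (trace_matrix ws *\<^sub>v ?v) i = vec_index (0\<^sub>v (length ws)) i" using i by simp
  qed (simp add: trace_matrix_def)
  hence "?v = 0\<^sub>v (length ws)"
    using assms(1) det_0_iff_vec_prod_zero[OF trace_matrix_carrier[of ws]] vec_carrier[of "length ws" c]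
    unfolding trace_det_def by blast
  hence "vec_index ?v j = 0" using assms(3) by simp
  thus ?thesis using assms(3) by simp
qed

lemma trace_det_integral:
  assumes "\<And>w. w \<in> set ws \<Longrightarrow> algebraic_int w"
  shows "trace_det ws \<in> \<int>"
proof -
  let ?n = "length ws"
  have entry: "trace_matrix ws $$ (i, j) \<in> \<int>" if "i < ?n" "j < ?n" for i j
    using assms that by (auto simp: trace_matrix_def intro!: nf_trace_integral algebraic_int_mult)
  have "Determinant.det (trace_matrix ws)
      = (\<Sum>p\<in>{p. p permutes {0..<?n}}. signof p * (\<Prod>i=0..<?n. trace_matrix ws $$ (i, p i)))"
    by (rule det_def') simp
  also have "\<dots> \<in> \<int>"
  proof (intro Ints_sum Ints_mult Ints_prod)
    fix p i assume "p \<in> {p. p permutes {0..<?n}}" "i \<in> {0..<?n}"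
    thus "trace_matrix ws $$ (i, p i) \<in> \<int>"
      using permutes_in_image[of p "{0..<?n}" i] by (intro entry) auto
  qed (simp add: sign_def)
  finally show ?thesis by (simp add: trace_det_def)
qed

text \<open>
  The trace matrix \<open>T\<close> becomes \<open>A * T * A\<^sup>T\<close>, where \<open>A\<close> is the identity matrix with row \<open>k\<close>
  replaced by \<open>c\<close>.
\<close>

lemma trace_det_replace:
  fixes ws :: "'k :: number_field list"
  assumes k: "k < length ws" and y: "y = (\<Sum>j<length ws. of_rat (c j) * ws ! j)"
  shows "trace_det (ws[k := y]) = (c k)\<^sup>2 * trace_det ws"
proof -
  let ?n = "length ws"
  let ?A = "Matrix.mat ?n ?n (\<lambda>(i, j). if i = k then c j else if i = j then 1 else 0)"
  let ?T = "trace_matrix ws"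
  have A: "?A \<in> carrier_mat ?n ?n" by simp
  have row: "(\<Sum>i<?n. of_rat (?A $$ (a, i)) * ws ! i) = ws[k := y] ! a" if a: "a < ?n" for a
  proof (cases "a = k")
    case False
    have "(\<Sum>i<?n. of_rat (?A $$ (a, i)) * ws ! i) = (\<Sum>i<?n. if i = a then ws ! i else 0)"
      using a False by (intro sum.cong) auto
    thus ?thesis using a False by simp
  qed (use a y in simp)
  have "trace_matrix (ws[k := y]) = ?A * (?T * ?A\<^sup>T)"
  proof (rule eq_matI)
    fix a b assume "a < dim_row (?A * (?T * ?A\<^sup>T))" "b < dim_col (?A * (?T * ?A\<^sup>T))"
    hence ab: "a < ?n" "b < ?n" by auto
    have inner: "(?T * ?A\<^sup>T) $$ (i, b) = nf_trace (ws ! i * ws[k := y] ! b)" if i: "i < ?n" for i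
    proof -
      have "(?T * ?A\<^sup>T) $$ (i, b) = (\<Sum>j<?n. ?A $$ (b, j) * nf_trace (ws ! i * ws ! j))"
        using i ab by (simp add: trace_matrix_def scalar_prod_def lessThan_atLeast0 mult.commute)
      also have "\<dots> = nf_trace (ws ! i * (\<Sum>j<?n. of_rat (?A $$ (b, j)) * ws ! j))"
        by (simp only: sum_distrib_left nf_trace_sum nf_trace_scale mult.left_commute[of "ws ! i"])
      also have "\<dots> = nf_trace (ws ! i * ws[k := y] ! b)" unfolding row[OF ab(2)] ..
      finally show ?thesis .
    qed
    have "(?A * (?T * ?A\<^sup>T)) $$ (a, b) = (\<Sum>i<?n. ?A $$ (a, i) * (?T * ?A\<^sup>T) $$ (i, b))"
      using ab by (simp add: trace_matrix_def scalar_prod_def lessThan_atLeast0)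
    also have "\<dots> = (\<Sum>i<?n. ?A $$ (a, i) * nf_trace (ws ! i * ws[k := y] ! b))"
      by (intro sum.cong refl) (simp only: inner lessThan_iff)
    also have "\<dots> = nf_trace ((\<Sum>i<?n. of_rat (?A $$ (a, i)) * ws ! i) * ws[k := y] ! b)"
      by (simp only: sum_distrib_right nf_trace_sum nf_trace_scale mult.assoc)
    also have "\<dots> = trace_matrix (ws[k := y]) $$ (a, b)"
      unfolding row[OF ab(1)] using ab by (simp add: trace_matrix_def)
    finally show "trace_matrix (ws[k := y]) $$ (a, b) = (?A * (?T * ?A\<^sup>T)) $$ (a, b)" ..
  qed (simp_all add: trace_matrix_def)
  hence "trace_det (ws[k := y]) = Determinant.det (?A * (?T * ?A\<^sup>T))" by (simp only: trace_det_def)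
  also have "\<dots> = Determinant.det ?A * Determinant.det (?T * ?A\<^sup>T)"
    by (rule det_mult[of _ ?n], rule A, rule mult_carrier_mat[of _ _ ?n]) auto
  also have "Determinant.det (?T * ?A\<^sup>T) = trace_det ws * Determinant.det ?A\<^sup>T"
    unfolding trace_det_def by (rule det_mult[of _ ?n]) auto
  also have "Determinant.det ?A\<^sup>T = Determinant.det ?A" by (rule det_transpose[OF A])
  also have "Determinant.det ?A = c k" by (rule det_identity_replace_row[OF k])
  finally show ?thesis by (simp add: power2_eq_square)
qed

text \<open>
  A \<open>\<rat>\<close>-basis of algebraic integers. Linear independence is expressed by the nonvanishing of
  \<open>trace_det\<close>, to which it is equivalent for spanning lists, and which an exchange of basis vectors
  changes in a controlled way.
\<close>

definition integral_rat_basis :: "'k :: number_field list \<Rightarrow> bool" where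
  "integral_rat_basis ws \<longleftrightarrow>
     (\<forall>w\<in>set ws. algebraic_int w) \<and> rat_vs.span (set ws) = UNIV \<and> trace_det ws \<noteq> 0"

lemma integral_rat_basis_exists: "\<exists>ws :: 'k :: number_field list. integral_rat_basis ws"
proof -
  obtain B :: "'k set" where B: "finite B" "rat_vs.independent B" "rat_vs.span B = UNIV"
    by (rule number_field_finite_basis)
  obtain bs where bs: "set bs = B" "distinct bs" using finite_distinct_list[OF B(1)] by blast
  have "\<forall>b :: 'k. \<exists>N :: int. N > 0 \<and> algebraic_int (of_int N * b)"
    by (meson integral_multiple)
  then obtain N :: "'k \<Rightarrow> int" where N: "\<forall>b. N b > 0 \<and> algebraic_int (of_int (N b) * b)"
    by (rule choice[THEN exE])
  define ws where "ws = map (\<lambda>b. of_int (N b) * b) bs"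
  have "\<forall>w\<in>set ws. algebraic_int w" using N by (auto simp: ws_def)
  moreover have span: "rat_vs.span (set ws) = UNIV"
  proof -
    have "b \<in> rat_vs.span (set ws)" if "b \<in> B" for b
    proof -
      have "b = rat_scale (inverse (of_int (N b))) (of_int (N b) * b)"
        using N[rule_format, of b] by (simp add: rat_scale_def of_rat_inverse)
      moreover have "of_int (N b) * b \<in> set ws" using that bs by (auto simp: ws_def)
      ultimately show ?thesis by (metis rat_vs.span_base rat_vs.span_scale)
    qed
    hence "rat_vs.span B \<subseteq> rat_vs.span (set ws)"
      by (intro rat_vs.span_minimal rat_vs.subspace_span) auto
    thus ?thesis using B(3) by auto
  qed
  moreover have "trace_det ws \<noteq> 0"
  proof (rule trace_det_nonzero[OF span])
    fix c j assume sum: "(\<Sum>j<length ws. of_rat (c j) * ws ! j) = 0" and j: "j < length ws"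
    have "(\<Sum>j<length bs. rat_scale (c j * of_int (N (bs ! j))) (bs ! j)) = 0"
      using sum by (simp add: ws_def rat_scale_def of_rat_mult mult.assoc)
    hence "c j * of_int (N (bs ! j)) = 0"
      using j bs B(2) by (intro rat_vs.sum_list_family_eq_0D[of bs]) (auto simp: ws_def)
    thus "c j = 0" using N[rule_format, of "bs ! j"] by simp
  qed
  ultimately show ?thesis unfolding integral_rat_basis_def by blast
qed

lemma integral_rat_basis_replace:
  fixes ws :: "'k :: number_field list"
  assumes ws: "integral_rat_basis ws" and k: "k < length ws"
    and y: "y = (\<Sum>j<length ws. of_rat (c j) * ws ! j)" "algebraic_int y" and ck: "c k \<noteq> 0"
  shows "integral_rat_basis (ws[k := y])"
proof -
  let ?S = "set (ws[k := y])"
  have mem: "ws ! j \<in> ?S" if "j < length ws" "j \<noteq> k" for j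
    using that nth_mem[of j "ws[k := y]"] by simp
  have yS: "y \<in> ?S" using k by (simp add: set_update_memI)
  have "y = of_rat (c k) * ws ! k + (\<Sum>j\<in>{..<length ws} - {k}. of_rat (c j) * ws ! j)"
    unfolding y(1) using k by (intro sum.remove) auto
  hence "ws ! k = rat_scale (inverse (c k)) (y - (\<Sum>j\<in>{..<length ws} - {k}. rat_scale (c j) (ws ! j)))"
    using ck by (simp add: rat_scale_def of_rat_inverse)
  also have "\<dots> \<in> rat_vs.span ?S"
    using mem yS by (intro rat_vs.span_scale rat_vs.span_diff rat_vs.span_sum rat_vs.span_base) auto
  finally have "ws ! k \<in> rat_vs.span ?S" .
  moreover have "ws ! j \<in> rat_vs.span ?S" if "j < length ws" "j \<noteq> k" for j
    by (rule rat_vs.span_base[OF mem[OF that]])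
  ultimately have "ws ! j \<in> rat_vs.span ?S" if "j < length ws" for j
    using that by (cases "j = k") simp_all
  hence "set ws \<subseteq> rat_vs.span ?S" by (auto simp: in_set_conv_nth)
  hence "rat_vs.span (set ws) \<subseteq> rat_vs.span ?S" by (intro rat_vs.span_minimal rat_vs.subspace_span)
  hence "rat_vs.span ?S = UNIV" using ws by (auto simp: integral_rat_basis_def)
  moreover have "\<forall>w\<in>?S. algebraic_int w"
    using ws y(2) set_update_subset_insert[of ws k y] by (auto simp: integral_rat_basis_def)
  moreover have "trace_det (ws[k := y]) \<noteq> 0"
    using ws ck by (simp add: trace_det_replace[OF k y(1)] integral_rat_basis_def)
  ultimately show ?thesis unfolding integral_rat_basis_def by blast
qed

text \<open>
  Among the \<open>\<rat>\<close>-bases of algebraic integers, one with minimal absolute value of the trace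
  determinant, a positive integer, is an integral basis. For suppose that an algebraic integer has
  a coefficient at \<open>ws ! k\<close> that is not an integer. Subtracting an integer multiple of \<open>ws ! k\<close>
  reduces this coefficient to its fractional part \<open>\<theta>\<close>, and putting the result in the place of
  \<open>ws ! k\<close> multiplies the trace determinant by \<open>\<theta>\<^sup>2 < 1\<close>.
\<close>

lemma integral_basis_exists: "\<exists>ws :: 'k :: number_field list. integral_basis ws"
proof -
  define size where "size ws = nat \<bar>\<lfloor>trace_det ws\<rfloor>\<bar>" for ws :: "'k list"
  obtain ws0 :: "'k list" where ws0: "integral_rat_basis ws0" using integral_rat_basis_exists by blast
  from ex_has_least_nat[of integral_rat_basis, OF ws0, of size]
  obtain ws :: "'k list" where ws: "integral_rat_basis ws"
    and min: "\<And>us. integral_rat_basis us \<Longrightarrow> size ws \<le> size us" by blast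
  let ?n = "length ws"
  let ?f = "\<lambda>c :: int list. \<Sum>i<?n. of_int (c ! i) * ws ! i"
  have int: "algebraic_int w" if "w \<in> set ws" for w using ws that by (simp add: integral_rat_basis_def)
  have span: "rat_vs.span (set ws) = UNIV" and det: "trace_det ws \<noteq> 0"
    using ws by (simp_all add: integral_rat_basis_def)
  have size: "of_nat (size us) = \<bar>trace_det us\<bar>" if "integral_rat_basis us" for us
  proof -
    have "trace_det us \<in> \<int>" using that by (intro trace_det_integral) (simp add: integral_rat_basis_def)
    then obtain z where "trace_det us = of_int z" by (auto elim: Ints_cases)
    thus ?thesis by (simp add: size_def)
  qed
  have integer: "c k \<in> \<int>" if x: "algebraic_int x" "x = (\<Sum>j<?n. of_rat (c j) * ws ! j)" and k: "k < ?n" for x c k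
  proof (rule ccontr)
    assume notint: "c k \<notin> \<int>"
    define \<theta> where "\<theta> = frac (c k)"
    have \<theta>: "0 < \<theta>" "\<theta> < 1" using notint by (simp_all add: \<theta>_def frac_gt_0_iff frac_lt_1)
    define y where "y = x + of_int (- \<lfloor>c k\<rfloor>) * ws ! k"
    have "x = of_rat (c k) * ws ! k + (\<Sum>j\<in>{..<?n} - {k}. of_rat (c j) * ws ! j)"
      unfolding x(2) using k by (intro sum.remove) auto
    hence "y = of_rat \<theta> * ws ! k + (\<Sum>j\<in>{..<?n} - {k}. of_rat (c j) * ws ! j)"
      by (simp add: y_def \<theta>_def frac_def of_rat_diff algebra_simps)
    also have "\<dots> = of_rat ((c(k := \<theta>)) k) * ws ! k
        + (\<Sum>j\<in>{..<?n} - {k}. of_rat ((c(k := \<theta>)) j) * ws ! j)"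
      by (intro arg_cong2[of _ _ _ _ "(+)"] sum.cong) auto
    also have "\<dots> = (\<Sum>j<?n. of_rat ((c(k := \<theta>)) j) * ws ! j)"
      using k by (intro sum.remove[symmetric]) auto
    finally have y: "y = (\<Sum>j<?n. of_rat ((c(k := \<theta>)) j) * ws ! j)" .
    have "algebraic_int y"
      unfolding y_def using k int by (intro algebraic_int_add x(1) algebraic_int_of_int_mult) auto
    hence us: "integral_rat_basis (ws[k := y])"
      using \<theta> by (intro integral_rat_basis_replace[OF ws k y]) auto
    have "\<bar>trace_det ws\<bar> \<le> \<bar>trace_det (ws[k := y])\<bar>"
      using min[OF us] by (simp flip: size[OF us] size[OF ws])
    also have "\<dots> = \<theta>\<^sup>2 * \<bar>trace_det ws\<bar>"
      by (simp add: trace_det_replace[OF k y] abs_mult)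
    also have "\<dots> < 1 * \<bar>trace_det ws\<bar>"
      using det \<theta> by (intro mult_strict_right_mono) (auto simp: abs_square_less_1)
    finally show False by simp
  qed
  have "bij_betw ?f {c. length c = ?n} ring_of_integers"
  proof (rule bij_betw_imageI)
    show "inj_on ?f {c. length c = ?n}"
    proof (rule inj_onI)
      fix c d :: "int list" assume "c \<in> {c. length c = ?n}" "d \<in> {c. length c = ?n}" and eq: "?f c = ?f d"
      hence len: "length c = ?n" "length d = ?n" by auto
      have "(\<Sum>i<?n. of_rat (of_int (c ! i - d ! i)) * ws ! i) = ?f c - ?f d"
        by (simp add: of_rat_diff sum_subtractf left_diff_distrib)
      hence "(\<Sum>i<?n. of_rat (of_int (c ! i - d ! i)) * ws ! i) = 0" using eq by simp
      hence "(of_int (c ! i - d ! i) :: rat) = 0" if "i < ?n" for i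
        by (rule trace_det_nonzero_independent[OF det _ that])
      thus "c = d" using len by (intro nth_equalityI) auto
    qed
    show "?f ` {c. length c = ?n} = ring_of_integers"
    proof (rule equalityI; rule subsetI)
      fix x assume "x \<in> ?f ` {c. length c = ?n}"
      then obtain c where x: "x = ?f c" by blast
      have "algebraic_int x"
        unfolding x using int by (intro algebraic_int_sum algebraic_int_of_int_mult) auto
      thus "x \<in> ring_of_integers" by (simp add: ring_of_integers_def)
    next
      fix x :: 'k assume "x \<in> ring_of_integers"
      hence x: "algebraic_int x" by (simp add: ring_of_integers_def)
      obtain c where c: "x = (\<Sum>j<?n. of_rat (c j) * ws ! j)"
        by (rule rat_span_list_coeffs[OF span])
      define d where "d = map (\<lambda>j. \<lfloor>c j\<rfloor>) [0..<?n]"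
      have "of_rat (c j) = (of_int (d ! j) :: 'k)" if j: "j < ?n" for j
      proof -
        obtain z where z: "c j = of_int z" using integer[OF x c j] by (rule Ints_cases)
        hence "d ! j = z" using j by (simp add: d_def)
        thus ?thesis by (simp add: z)
      qed
      hence "x = ?f d" unfolding c by (intro sum.cong) auto
      thus "x \<in> ?f ` {c. length c = ?n}" by (intro image_eqI[of _ _ d]) (auto simp: d_def)
    qed
  qed
  thus ?thesis unfolding integral_basis_def by blast
qed

text \<open>
  An integral basis is a \<open>\<rat>\<close>-basis: it spans because every element of the field has an
  integral multiple, and it is independent because clearing denominators turns a rational relation
  into an integral one.
\<close>

lemma integral_basis_trace_det:
  fixes ws :: "'k :: number_field list"
  assumes "integral_basis ws"
  shows "trace_det ws \<in> \<int>" "trace_det ws \<noteq> 0"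
proof -
  let ?n = "length ws"
  let ?f = "\<lambda>c :: int list. \<Sum>i<?n. of_int (c ! i) * ws ! i"
  have bij: "bij_betw ?f {c. length c = ?n} ring_of_integers"
    using assms by (simp add: integral_basis_def)
  have "algebraic_int w" if w: "w \<in> set ws" for w
  proof -
    obtain k where k: "k < ?n" "w = ws ! k" using w by (auto simp: in_set_conv_nth)
    let ?c = "map (\<lambda>i. if i = k then 1 else 0 :: int) [0..<?n]"
    have "?f ?c = (\<Sum>i<?n. if i = k then ws ! i else 0)" by (intro sum.cong) auto
    also have "\<dots> = w" using k by simp
    finally have "w \<in> ?f ` {c. length c = ?n}" by (intro image_eqI[of _ _ ?c]) auto
    thus ?thesis using bij by (auto simp: bij_betw_def ring_of_integers_def)
  qed
  thus "trace_det ws \<in> \<int>" by (rule trace_det_integral)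
  have span: "rat_vs.span (set ws) = UNIV"
  proof (rule UNIV_eq_I[symmetric])
    fix x :: 'k
    obtain N :: int where N: "N > 0" "algebraic_int (of_int N * x)" by (rule integral_multiple)
    hence "of_int N * x \<in> ?f ` {c. length c = ?n}" using bij by (simp add: bij_betw_def ring_of_integers_def)
    then obtain c where c: "of_int N * x = ?f c" by blast
    have "x = rat_scale (inverse (of_int N)) (of_int N * x)"
      using N(1) by (simp add: rat_scale_def of_rat_inverse)
    also have "of_int N * x = (\<Sum>i<?n. rat_scale (of_int (c ! i)) (ws ! i))"
      unfolding c by (simp add: rat_scale_def)
    also have "rat_scale (inverse (of_int N)) \<dots> \<in> rat_vs.span (set ws)"
      by (intro rat_vs.span_scale rat_vs.span_sum rat_vs.span_base) auto
    finally show "x \<in> rat_vs.span (set ws)" .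
  qed
  show "trace_det ws \<noteq> 0"
  proof (rule trace_det_nonzero[OF span])
    fix c :: "nat \<Rightarrow> rat" and j
    assume sum: "(\<Sum>j<?n. of_rat (c j) * ws ! j) = 0" and j: "j < ?n"
    obtain N :: int where N: "N > 0" "\<And>q. q \<in> c ` {..<?n} \<Longrightarrow> of_int N * q \<in> \<int>"
      by (rule common_denominator[of "c ` {..<?n}"]) auto
    define d where "d = map (\<lambda>j. \<lfloor>of_int N * c j\<rfloor>) [0..<?n]"
    have d: "of_int (d ! i) = of_int N * c i" if "i < ?n" for i
    proof -
      have "of_int N * c i \<in> \<int>" using that by (intro N(2)) auto
      then obtain z where z: "of_int N * c i = of_int z" by (rule Ints_cases)
      have "d ! i = \<lfloor>of_int N * c i\<rfloor>" using that by (simp add: d_def)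
      thus ?thesis unfolding z by simp
    qed
    have "?f d = (\<Sum>i<?n. of_int N * (of_rat (c i) * ws ! i))"
    proof (rule sum.cong)
      fix i assume "i \<in> {..<?n}"
      hence "(of_rat (of_int (d ! i)) :: 'k) = of_rat (of_int N * c i)" using d by simp
      thus "of_int (d ! i) * ws ! i = of_int N * (of_rat (c i) * ws ! i)" by (simp add: of_rat_mult)
    qed simp
    also have "\<dots> = 0" by (simp only: sum_distrib_left[symmetric] sum mult_zero_right)
    also have "0 = ?f (replicate ?n 0)" by simp
    finally have "d = replicate ?n 0"
      using bij by (elim bij_betw_imp_inj_on[THEN inj_onD]) (auto simp: d_def)
    hence "of_int N * c j = 0" using d[OF j] j by simp
    thus "c j = 0" using N(1) by simp
  qed
qed

lemma abs_discriminant_ge_1: "1 \<le> \<bar>discriminant TYPE('k :: number_field)\<bar>"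
proof -
  define ws where "ws = (SOME ws :: 'k list. integral_basis ws)"
  have ws: "integral_basis ws" unfolding ws_def using integral_basis_exists by (rule someI_ex)
  have disc: "discriminant TYPE('k) = trace_det ws"
    by (simp add: discriminant_def trace_det_def trace_matrix_def ws_def Let_def)
  obtain z where z: "trace_det ws = of_int z" using integral_basis_trace_det(1)[OF ws] by (auto elim: Ints_cases)
  hence "z \<noteq> 0" using integral_basis_trace_det(2)[OF ws] by auto
  hence "1 \<le> \<bar>z\<bar>" by linarith
  hence "(of_int 1 :: rat) \<le> of_int \<bar>z\<bar>" by (simp only: of_int_le_iff)
  thus ?thesis by (simp add: disc z)
qed

section \<open>Zeros of multilinear forms\<close>

lemma basis_list_exists:
  fixes V :: "('k :: field ^ 'n :: finite) set"
  assumes "vec.subspace V"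
  shows "\<exists>xs. basis_list xs V"
proof -
  obtain B where B: "B \<subseteq> V" "vec.independent B" "V \<subseteq> vec.span B" "card B = vec.dim V"
    by (rule vec.basis_exists)
  have fin: "finite B" using B(2) by (rule vec.finiteI_independent)
  obtain xs where xs: "set xs = B" "distinct xs" using finite_distinct_list[OF fin] by blast
  have "vec.span B \<subseteq> V" using B(1) assms by (rule vec.span_minimal)
  hence "basis_list xs V" using xs B by (auto simp: basis_list_def)
  thus ?thesis by blast
qed

lemma basis_list_length:
  assumes "basis_list xs V"
  shows "length xs = vec.dim V"
  using assms vec.dim_span_eq_card_independent[of "set xs"]
  by (auto simp: basis_list_def distinct_card)

text \<open>
  The echelon basis is multiplied by the Grassmann coordinate \<open>d\<close> at the pivots, taken in the basis
  \<open>ys\<close> that the definition of the Schmidt height chooses. The resulting coordinates are \<open>0\<close>,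
  \<open>d\<close>, or another Grassmann coordinate up to sign. Each vector vanishes at all pivots but one,
  which bounds the number of nonzero coordinates.
\<close>

lemma sparse_basis_of_small_height:
  fixes V :: "('k :: number_field ^ 'n :: {finite, linorder}) set"
  assumes V: "vec.subspace V"
  shows "\<exists>zs. basis_list zs V \<and> (\<forall>z\<in>set zs. vec_height z \<le> schmidt_height V \<and>
           card {r. z $ r \<noteq> 0} + vec.dim V \<le> CARD('n) + 1)"
proof -
  obtain I x where card: "card I = vec.dim V"
    and xV: "\<And>i. i \<in> I \<Longrightarrow> x i \<in> V"
    and delta: "\<And>i j. i \<in> I \<Longrightarrow> j \<in> I \<Longrightarrow> x i $ j = (if i = j then 1 else 0)"
    and expand: "\<And>y. y \<in> V \<Longrightarrow> y = (\<Sum>i\<in>I. y $ i *s x i)"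
    by (rule echelon_basis[OF V]) blast
  define ys where "ys = (SOME xs. basis_list xs V)"
  have ys: "basis_list ys V" unfolding ys_def using basis_list_exists[OF V] by (rule someI_ex)
  have len: "length ys = card I" using basis_list_length[OF ys] card by simp
  let ?G = "grassmann_coord ys" and ?J = "{J. card J = length ys}"
  have schmidt: "schmidt_height V = l2_height ?J ?G"
    by (simp add: schmidt_height_def ys_def Let_def)
  define d where "d = ?G I"
  have d: "d \<noteq> 0" unfolding d_def by (rule grassmann_coord_pivots_nonzero[OF ys len delta expand])
  define z where "z i = d *s x i" for i
  have zI: "z i $ j = (if i = j then d else 0)" if "i \<in> I" "j \<in> I" for i j
    using delta[OF that] by (simp add: z_def)
  have inj: "inj_on z I"
  proof (rule inj_onI, rule ccontr)
    fix i j assume "i \<in> I" "j \<in> I" "z i = z j" "i \<noteq> j"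
    thus False using zI[of i j] zI[of j j] d by simp
  qed
  define zs where "zs = map z (sorted_list_of_set I)"
  have set_zs: "set zs = z ` I" by (simp add: zs_def)
  have zV: "z i \<in> V" if "i \<in> I" for i
    using vec.subspace_scale[OF V xV[OF that]] by (simp add: z_def)
  have V_sub: "V \<subseteq> vec.span (z ` I)"
  proof
    fix y assume "y \<in> V"
    have "x i = inverse d *s z i" for i using d by (simp add: z_def)
    hence "(\<Sum>i\<in>I. y $ i *s x i) \<in> vec.span (z ` I)"
      by (simp only:) (intro vec.span_sum vec.span_scale vec.span_base imageI)
    thus "y \<in> vec.span (z ` I)" using expand[OF \<open>y \<in> V\<close>] by (rule back_subst[OF _ sym])
  qed
  have "vec.independent (z ` I)"
    using zV V_sub card card_image[OF inj] by (intro vec.card_le_dim_spanning[of _ V]) auto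
  moreover have "vec.span (z ` I) \<subseteq> V" using zV by (intro vec.span_minimal[OF _ V]) auto
  ultimately have "basis_list zs V"
    using V_sub inj unfolding basis_list_def set_zs by (auto simp: zs_def distinct_map)
  moreover have "vec_height (z i) \<le> schmidt_height V" if i: "i \<in> I" for i
    unfolding vec_height_def schmidt
  proof (rule height_le_l2_height)
    show "\<exists>J\<in>?J. ?G J \<noteq> 0" using d len by (intro bexI[of _ I]) (auto simp: d_def)
    fix v :: "'k \<Rightarrow> real" and r :: 'n
    assume v: "absolute_value v"
    show "\<exists>J\<in>?J. v (z i $ r) \<le> v (?G J)"
    proof (cases "r \<in> I")
      case True
      hence "z i $ r = d \<or> z i $ r = 0" using zI[OF i True] by simp
      hence "v (z i $ r) \<le> v (?G I)"
        using absolute_value_nonneg[OF v] absolute_value_zero[OF v] by (auto simp: d_def)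
      thus ?thesis using len by auto
    next
      case False
      obtain p where "d * x i $ r = signof p * ?G (insert r (I - {i}))"
        using grassmann_coord_exchange[OF ys len delta expand i False] by (auto simp: d_def)
      hence "v (z i $ r) = v (?G (insert r (I - {i})))"
        by (simp add: z_def absolute_value_signof[OF v])
      moreover have "card (insert r (I - {i})) = length ys"
        using False i len card_Suc_Diff1[of I i] by simp
      ultimately show ?thesis by auto
    qed
  qed auto
  moreover have "card {r. z i $ r \<noteq> 0} + vec.dim V \<le> CARD('n) + 1" if i: "i \<in> I" for i
  proof -
    have "{r. z i $ r \<noteq> 0} \<subseteq> UNIV - (I - {i})" using zI[OF i] i by (auto split: if_splits)
    hence "card {r. z i $ r \<noteq> 0} \<le> card (UNIV - (I - {i}))" by (intro card_mono) auto
    also have "\<dots> = CARD('n) - (card I - 1)" using i by (simp add: card_Diff_subset)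
    finally show ?thesis using card_mono[of UNIV I] card by simp
  qed
  ultimately show ?thesis using set_zs by (intro exI[of _ zs]) auto
qed

text \<open>
  Every monomial contains \<open>g\<close> distinct variables, and one of them vanishes at \<open>z\<close>.
\<close>

lemma multilinear_form_vanishes:
  fixes F :: "('n :: finite, 'k :: field) mpoly"
  assumes F: "multilinear_form g F" and supp: "card {i. z $ i \<noteq> 0} < g"
  shows "mpoly_eval F z = 0"
  unfolding mpoly_eval_def
proof (intro sum.neutral ballI)
  fix e assume e: "e \<in> Poly_Mapping.keys F"
  have "\<exists>i. Poly_Mapping.lookup e i \<noteq> 0 \<and> z $ i = 0"
  proof (rule ccontr)
    assume "\<not> ?thesis"
    hence "Poly_Mapping.lookup e i \<le> (if z $ i \<noteq> 0 then 1 else 0)" for i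
      using F e by (auto simp: multilinear_form_def)
    hence "(\<Sum>i\<in>UNIV. Poly_Mapping.lookup e i) \<le> (\<Sum>i\<in>UNIV. if z $ i \<noteq> 0 then 1 else 0)"
      by (intro sum_mono)
    also have "\<dots> = card {i. z $ i \<noteq> 0}" by (simp flip: sum.inter_filter)
    finally show False using F e supp by (auto simp: multilinear_form_def)
  qed
  then obtain i where "Poly_Mapping.lookup e i \<noteq> 0" "z $ i = 0" by blast
  hence "(\<Prod>i\<in>UNIV. z $ i ^ Poly_Mapping.lookup e i) = 0" by (intro prod_zero) auto
  thus "Poly_Mapping.lookup F e * (\<Prod>i\<in>UNIV. z $ i ^ Poly_Mapping.lookup e i) = 0" by simp
qed

lemma schmidt_height_nonneg:
  fixes V :: "('k :: number_field ^ 'n :: {finite, linorder}) set"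
  assumes "vec.subspace V"
  shows "0 \<le> schmidt_height V"
proof -
  define ys where "ys = (SOME xs. basis_list xs V)"
  have ys: "basis_list ys V" unfolding ys_def using basis_list_exists[OF assms] by (rule someI_ex)
  have "length ys \<le> CARD('n)"
    using basis_list_length[OF ys] vec.dim_subset_UNIV[of V] by (simp add: vec.dimension_def card_cart_basis)
  then obtain J :: "'n set" where "card J = length ys"
    using obtain_subset_with_card_n[of "length ys" UNIV] by auto
  hence "0 \<le> l2_height {J. card J = length ys} (grassmann_coord ys)"
    by (intro l2_height_nonneg) auto
  thus ?thesis by (simp add: schmidt_height_def ys_def Let_def)
qed

theorem theorem1p3:
  fixes V :: "('k :: number_field ^ 'n :: {finite, linorder}) set"
    and F :: "('n, 'k) mpoly"
    and m g :: nat
  assumes "vec.subspace V" and "vec.dim V = m"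
    and "multilinear_form g F"
    and "m + g - 1 > CARD('n)" and "g > 1"
  shows "(\<exists>xs. length xs = m \<and> basis_list xs V \<and>
           (\<forall>x\<in>set xs. mpoly_eval F x = 0 \<and>
              vec_height x
                \<le> sqrt 2 * real m
                   * \<bar>real_of_rat (discriminant TYPE('k))\<bar>
                       powr (real (m + 1) / (2 * real (nf_degree TYPE('k))))
                   * schmidt_height V)) \<and>
         (\<forall>P :: ('n, 'k) mpoly. vec.dim (vec.span (zero_set P V)) < m \<longrightarrow>
           (\<exists>z \<in> V - zero_set P V. mpoly_eval F z = 0 \<and>
              vec_height z
                \<le> sqrt 2 * real m
                   * \<bar>real_of_rat (discriminant TYPE('k))\<bar>
                       powr (real (m + 1) / (2 * real (nf_degree TYPE('k))))
                   * schmidt_height V))"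
proof -
  let ?C = "sqrt 2 * real m * \<bar>real_of_rat (discriminant TYPE('k))\<bar>
              powr (real (m + 1) / (2 * real (nf_degree TYPE('k))))"
  obtain xs where xs: "basis_list xs V"
    and small: "\<forall>x\<in>set xs. vec_height x \<le> schmidt_height V \<and> card {r. x $ r \<noteq> 0} + vec.dim V \<le> CARD('n) + 1"
    using sparse_basis_of_small_height[OF assms(1)] by blast
  have len: "length xs = m" using basis_list_length[OF xs] assms(2) by simp
  have V: "V = vec.span (set xs)" using xs by (simp add: basis_list_def)
  have good: "mpoly_eval F x = 0 \<and> vec_height x \<le> ?C * schmidt_height V" if x: "x \<in> set xs" for x
  proof
    show "mpoly_eval F x = 0"
    proof (rule multilinear_form_vanishes[OF assms(3)])
      have "card {r. x $ r \<noteq> 0} + m \<le> CARD('n) + 1" using small x assms(2) by blast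
      thus "card {r. x $ r \<noteq> 0} < g" using assms(4) by linarith
    qed
    have "m \<ge> 1" using len x by (cases xs) auto
    hence "1 * 1 \<le> sqrt 2 * real m" by (intro mult_mono) auto
    moreover have "1 \<le> \<bar>real_of_rat (discriminant TYPE('k))\<bar>"
      using abs_discriminant_ge_1[where 'k = 'k] by simp
    hence "1 \<le> \<bar>real_of_rat (discriminant TYPE('k))\<bar> powr (real (m + 1) / (2 * real (nf_degree TYPE('k))))"
      by (intro ge_one_powr_ge_zero) auto
    ultimately have "1 * 1 \<le> ?C" by (intro mult_mono) auto
    hence "1 * schmidt_height V \<le> ?C * schmidt_height V"
      using schmidt_height_nonneg[OF assms(1)] by (intro mult_right_mono) auto
    moreover have "vec_height x \<le> schmidt_height V" using small x by blast
    ultimately show "vec_height x \<le> ?C * schmidt_height V" by linarith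
  qed
  moreover have "\<exists>z \<in> V - zero_set P V. mpoly_eval F z = 0 \<and> vec_height z \<le> ?C * schmidt_height V"
    if dim: "vec.dim (vec.span (zero_set P V)) < m" for P :: "('n, 'k) mpoly"
  proof -
    \<comment> \<open>The basis vectors cannot all lie in a set that spans less than \<open>V\<close>.\<close>
    have "\<not> set xs \<subseteq> zero_set P V"
    proof
      assume "set xs \<subseteq> zero_set P V"
      hence "V \<subseteq> vec.span (zero_set P V)" unfolding V by (rule vec.span_mono)
      hence "m \<le> vec.dim (vec.span (zero_set P V))" using vec.dim_subset assms(2) by blast
      thus False using dim by simp
    qed
    then obtain x where "x \<in> set xs" "x \<notin> zero_set P V" by blast
    moreover from this have "x \<in> V" unfolding V by (intro vec.span_base)
    ultimately show ?thesis using good by blast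
  qed
  ultimately show ?thesis using xs len by (intro conjI exI[of _ xs] ballI allI impI) simp_all
qed

end
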